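(* Let $Q$ be a nonzero quadratic form on $\mathbb{F}_{q_1}/\mathbb{F}_q$ with rank $r_Q$, and let $\mathcal{C}_{Q,N}$ be the $\mathbb{F}_p$-linear code obtained by descending $\mathcal{C}_Q$ (as described in the context). For each $r$ with $1\le r\le m(m_2+1)$: (1) if $r_Q$ is even and $\epsilon=1$, then $d_r(\mathcal{C}_{Q,N})=\frac{q^M(q-1)}{p^rN}(p^r-1)(1-q^{-r_Q/2})$ for $r\le m$, and $d_r(\mathcal{C}_{Q,N})=\frac{q^M(q-1)}{p^rN}\bigl(p^r-1-q^{-r_Q/2}(q-1)\bigr)$ for $r>m$; (2) if $r_Q$ is even and $\epsilon=-1$, then $d_r(\mathcal{C}_{Q,N})=\frac{q^M(q-1)}{p^rN}(p^r-1)$ for $r\le mm_2$, and $d_r(\mathcal{C}_{Q,N})=\frac{q^M(q-1)}{p^rN}\bigl(p^r-1+q^{-r_Q/2}(p^{r-mm_2}-1)\bigr)$ for $r>mm_2$; (3) if $r_Q$ is odd, then $d_r(\mathcal{C}_{Q,N})=\frac{q^M(q-1)}{p^rN}(p^r-1)$.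
   Context: Let $p$ be an odd prime, $m\ge1$, $q=p^m$. Let $m_1,m_2$ be positive integers, $M=m_1+m_2$, $q_i=q^{m_i}$, $\mathbb{F}=\mathbb{F}_{q_1}\times\mathbb{F}_{q_2}$, $\mathbb{F}^\star=\mathbb{F}\setminus\{(0,0)\}$. $\mathrm{Tr}_{q^s/q}$ is the trace $\mathbb{F}_{q^s}\to\mathbb{F}_q$; $\eta$ is the quadratic character of $\mathbb{F}_q$ with $\eta(0)=0$. A quadratic form $Q$ on $\mathbb{F}_{q_1}/\mathbb{F}_q$ is a map $Q:\mathbb{F}_{q_1}\to\mathbb{F}_q$ with $Q(ax)=a^2Q(x)$ ($a\in\mathbb{F}_q$) such that $B_Q(x,y)=\frac12(Q(x+y)-Q(x)-Q(y))$ is $\mathbb{F}_q$-bilinear; rank $r_Q=m_1-\dim_{\mathbb{F}_q}\{x:B_Q(x,y)=0\ \forall y\}$; in suitable coordinates $Q=\sum_{i=1}^{r_Q}\lambda_ix_i^2$, $\lambda_i\in\mathbb{F}_q^*$, and $\varepsilon_Q=\eta(\lambda_1\cdots\lambda_{r_Q})$. $\epsilon=\varepsilon_Q(-1)^{(p-1)mr_Q/4}$ if $r_Q$ even, $\epsilon=\varepsilon_Q(-1)^{(p-1)m(r_Q+1)/4}$ if $r_Q$ odd. Let $\mathcal{C}_Q=\{(aQ(x)+\mathrm{Tr}_{q_2/q}(by))_{(x,y)\in\mathbb{F}^\star}:(a,b)\in\mathbb{F}_q\times\mathbb{F}_{q_2}\}$, of length $n=q^M-1$. Let $N$ be a positive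 divisor of $p-1$ with $\gcd(N,\frac{q-1}{p-1})=1$, and let $\theta$ be a primitive $\frac{q-1}{N}$-th root of unity in $\mathbb{F}_q$. For $\gamma\in\mathbb{F}_q$ let $\psi_\gamma=(\mathrm{Tr}_{q/p}(\gamma\theta^i))_{0\le i<\frac{q-1}{N}}\in\mathbb{F}_p^{(q-1)/N}$. Define $\mathcal{C}_{Q,N}=\{(\psi_{c_1},\dots,\psi_{c_n}):(c_1,\dots,c_n)\in\mathcal{C}_Q\}\subseteq\mathbb{F}_p^{n(q-1)/N}$ (concatenation), an $\mathbb{F}_p$-linear code. For a linear code $\mathcal{C}$ over $\mathbb{F}_p$ of dimension $k$ and $1\le r\le k$, $d_r(\mathcal{C})$ is the minimum of $\#\mathrm{Supp}(K)$ over $r$-dimensional $\mathbb{F}_p$-subspaces $K\subseteq\mathcal{C}$, where $\mathrm{Supp}(K)$ is the set of coordinates where some codeword of $K$ is nonzero. *)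

theory Defs
  imports Main "HOL-Computational_Algebra.Primes" Complex_Main
begin

text \<open>All finite fields are realised inside one ambient field 'k of characteristic p:
  the field with p^e elements is the set of roots of X^(p^e) - X.\<close>

definition Fsub :: "nat \<Rightarrow> nat \<Rightarrow> 'k::field set" where
  "Fsub p e = {x. x ^ (p ^ e) = x}"

definition trace :: "nat \<Rightarrow> nat \<Rightarrow> nat \<Rightarrow> 'k::field \<Rightarrow> 'k" where
  "trace p e s x = (\<Sum>i<s. x ^ ((p ^ e) ^ i))"

definition indep_k :: "'k::field set \<Rightarrow> (nat \<Rightarrow> 'k) \<Rightarrow> nat \<Rightarrow> bool" where
  "indep_k F e r \<longleftrightarrow> (\<forall>c. (\<forall>i<r. c i \<in> F) \<longrightarrow> (\<Sum>i<r. c i * e i) = 0 \<longrightarrow> (\<forall>i<r. c i = 0))"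

definition span_k :: "'k::field set \<Rightarrow> (nat \<Rightarrow> 'k) \<Rightarrow> nat \<Rightarrow> 'k set" where
  "span_k F e r = {\<Sum>i<r. c i * e i | c. \<forall>i<r. c i \<in> F}"

definition is_basis_k :: "'k::field set \<Rightarrow> 'k set \<Rightarrow> (nat \<Rightarrow> 'k) \<Rightarrow> nat \<Rightarrow> bool" where
  "is_basis_k F W e r \<longleftrightarrow> (\<forall>i<r. e i \<in> W) \<and> indep_k F e r \<and> span_k F e r = W"

definition dim_k :: "'k::field set \<Rightarrow> 'k set \<Rightarrow> nat" where
  "dim_k F W = (THE r. \<exists>e. is_basis_k F W e r)"

text \<open>Quadratic forms on F_{q1}/F_q, q = p^m, q1 = q^m1.\<close>
definition bil :: "('k::field \<Rightarrow> 'k) \<Rightarrow> 'k \<Rightarrow> 'k \<Rightarrow> 'k" where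
  "bil Q x y = (Q (x + y) - Q x - Q y) / 2"

definition is_quad_form :: "nat \<Rightarrow> nat \<Rightarrow> nat \<Rightarrow> ('k::field \<Rightarrow> 'k) \<Rightarrow> bool" where
  "is_quad_form p m m1 Q \<longleftrightarrow>
     (\<forall>x\<in>Fsub p (m*m1). Q x \<in> Fsub p m) \<and>
     (\<forall>a\<in>Fsub p m. \<forall>x\<in>Fsub p (m*m1). Q (a * x) = a^2 * Q x) \<and>
     (\<forall>x\<in>Fsub p (m*m1). \<forall>y\<in>Fsub p (m*m1). \<forall>z\<in>Fsub p (m*m1). \<forall>a\<in>Fsub p m.
        bil Q (x + z) y = bil Q x y + bil Q z y \<and> bil Q (a * x) y = a * bil Q x y \<and>
        bil Q x (y + z) = bil Q x y + bil Q x z \<and> bil Q x (a * y) = a * bil Q x y)"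

definition qf_rank :: "nat \<Rightarrow> nat \<Rightarrow> nat \<Rightarrow> ('k::field \<Rightarrow> 'k) \<Rightarrow> nat" where
  "qf_rank p m m1 Q = m1 - dim_k (Fsub p m)
      {x\<in>Fsub p (m*m1). \<forall>y\<in>Fsub p (m*m1). bil Q x y = 0}"

definition eta :: "nat \<Rightarrow> nat \<Rightarrow> 'k::field \<Rightarrow> int" where
  "eta p m x = (if x = 0 then 0 else if \<exists>y\<in>Fsub p m. y^2 = x then 1 else -1)"

definition is_diag :: "nat \<Rightarrow> nat \<Rightarrow> nat \<Rightarrow> ('k::field \<Rightarrow> 'k) \<Rightarrow> (nat \<Rightarrow> 'k) \<Rightarrow> bool" where
  "is_diag p m m1 Q lam \<longleftrightarrow> (\<forall>i<qf_rank p m m1 Q. lam i \<in> Fsub p m - {0}) \<and>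
     (\<exists>e. is_basis_k (Fsub p m) (Fsub p (m*m1)) e m1 \<and>
        (\<forall>c. (\<forall>i<m1. c i \<in> Fsub p m) \<longrightarrow>
           Q (\<Sum>i<m1. c i * e i) = (\<Sum>i<qf_rank p m m1 Q. lam i * (c i)^2)))"

definition eps_Q :: "nat \<Rightarrow> nat \<Rightarrow> nat \<Rightarrow> ('k::field \<Rightarrow> 'k) \<Rightarrow> int" where
  "eps_Q p m m1 Q = eta p m (\<Prod>i<qf_rank p m m1 Q. (SOME lam. is_diag p m m1 Q lam) i)"

definition eps_sign :: "nat \<Rightarrow> nat \<Rightarrow> nat \<Rightarrow> ('k::field \<Rightarrow> 'k) \<Rightarrow> int" where
  "eps_sign p m m1 Q = (let r = qf_rank p m m1 Q in
     if even r then eps_Q p m m1 Q * (-1) ^ ((p - 1) * m * r div 4)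
     else eps_Q p m m1 Q * (-1) ^ ((p - 1) * m * (r + 1) div 4))"

text \<open>Codes over F_p (realised as subset F of 'k) with coordinates indexed by a finite set I;
  codewords are functions vanishing outside I.\<close>
definition cw_indep :: "'k::field set \<Rightarrow> (nat \<Rightarrow> 'i \<Rightarrow> 'k) \<Rightarrow> nat \<Rightarrow> bool" where
  "cw_indep F v r \<longleftrightarrow> (\<forall>c. (\<forall>i<r. c i \<in> F) \<longrightarrow> (\<lambda>j. \<Sum>i<r. c i * v i j) = (\<lambda>j. 0) \<longrightarrow> (\<forall>i<r. c i = 0))"

definition cw_span :: "'k::field set \<Rightarrow> (nat \<Rightarrow> 'i \<Rightarrow> 'k) \<Rightarrow> nat \<Rightarrow> ('i \<Rightarrow> 'k) set" where
  "cw_span F v r = {(\<lambda>j. \<Sum>i<r. c i * v i j) | c. \<forall>i<r. c i \<in> F}"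

definition subspaces_dim :: "'k::field set \<Rightarrow> ('i \<Rightarrow> 'k) set \<Rightarrow> nat \<Rightarrow> ('i \<Rightarrow> 'k) set set" where
  "subspaces_dim F C r = {K. \<exists>v. (\<forall>i<r. v i \<in> C) \<and> cw_indep F v r \<and> K = cw_span F v r}"

definition supp :: "'i set \<Rightarrow> ('i \<Rightarrow> 'k::zero) set \<Rightarrow> 'i set" where
  "supp I K = {j\<in>I. \<exists>w\<in>K. w j \<noteq> 0}"

definition ghw :: "'k::field set \<Rightarrow> 'i set \<Rightarrow> ('i \<Rightarrow> 'k) set \<Rightarrow> nat \<Rightarrow> nat" where
  "ghw F I C r = Min ((\<lambda>K. card (supp I K)) ` subspaces_dim F C r)"

definition idx :: "nat \<Rightarrow> nat \<Rightarrow> nat \<Rightarrow> nat \<Rightarrow> nat \<Rightarrow> (('k::field \<times> 'k) \<times> nat) set" where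
  "idx p m m1 m2 N = ((Fsub p (m*m1) \<times> Fsub p (m*m2)) - {(0,0)}) \<times> {..< (p^m - 1) div N}"

definition code_QN :: "nat \<Rightarrow> nat \<Rightarrow> nat \<Rightarrow> nat \<Rightarrow> nat \<Rightarrow> ('k::field \<Rightarrow> 'k) \<Rightarrow> 'k
    \<Rightarrow> ((('k \<times> 'k) \<times> nat) \<Rightarrow> 'k) set" where
  "code_QN p m m1 m2 N Q \<theta> =
     {(\<lambda>((x,y),i). if ((x,y),i) \<in> idx p m m1 m2 N
         then trace p 1 m ((a * Q x + trace p m m2 (b * y)) * \<theta> ^ i) else 0)
      | a b. a \<in> Fsub p m \<and> b \<in> Fsub p (m*m2)}"

end

theory Submission
  imports Defs "HOL-Computational_Algebra.Polynomial" "HOL-Library.FuncSet" "HOL-Library.Product_Plus"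
begin

text \<open>
  An \<open>r\<close>-dimensional subcode corresponds to an \<open>r\<close>-dimensional \<open>Fp\<close>-subspace \<open>H\<close> of
  \<open>Fq \<times> L\<close>. By the coprimality assumption, every element of \<open>Fq - {0}\<close> is a product of a
  nonzero scalar of \<open>Fp\<close> and a power of \<open>\<theta>\<close> in the same number of ways, so \<open>N\<close> times the number
  of coordinates at which the subcode vanishes is the number of \<open>(x, y, z)\<close>, \<open>z \<in> Fq - {0}\<close>, with
  \<open>Tr (z (a Q(x) + Tr (b y))) = 0\<close> for all \<open>(a, b) \<in> H\<close>. No character sums are needed: a nonzero
  \<open>Fp\<close>-linear functional takes every value equally often, so counting the pairs
  \<open>((x, y, z), (a, b))\<close> with vanishing trace in two ways expresses that number through the number of
  zeros of \<open>Q\<close> and the size of \<open>{a. (a, 0) \<in> H}\<close>. The weight is monotone in this size, in a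
  direction given by the sign of the deviation of the number of zeros of \<open>Q\<close> from its average, and the
  extreme sizes are attained. The zeros of \<open>Q\<close> are counted by diagonalising \<open>Q\<close> and adding one
  variable at a time.
\<close>

section \<open>Vector spaces over a finite subfield\<close>

text \<open>A subspace \<open>H\<close> enters the count through one number only, for this reason.
  If b is nonzero then, for fixed x and z, y |-> tr(z Tr(b y)) is already a nonzero functional, so
  (a, b) annihilates exactly one triple in p, whatever Q is. Only the pairs (a, 0) with a nonzero
  see Q, and since z runs through all nonzero elements of \<open>Fq\<close>, they all annihilate
  equally many triples. An r-dimensional \<open>H\<close> meets \<open>Fq \<times> {0}\<close> in at
  most min(p^r, q) elements and in at least p^max(0, r - m m2); these two extremes are the origin of
  the thresholds r = m and r = m m2. The ambient field is arbitrary, and only the two extensions of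
  \<open>Fq\<close> are assumed to have their full size, so the sizes of \<open>Fq\<close> and of
  the prime field have to be derived. Dimensions are handled through cardinalities throughout, and
  counts are multiplied by p, q or N so as to remain identities between integers.\<close>

locale finite_subfield =
  fixes F :: "'k::field set"
  assumes fin_F: "finite F"
    and zero_F: "0 \<in> F" and one_F: "1 \<in> F"
    and add_F: "a \<in> F \<Longrightarrow> b \<in> F \<Longrightarrow> a + b \<in> F"
    and mult_F: "a \<in> F \<Longrightarrow> b \<in> F \<Longrightarrow> a * b \<in> F"
    and uminus_F: "a \<in> F \<Longrightarrow> - a \<in> F"
    and inverse_F: "a \<in> F \<Longrightarrow> inverse a \<in> F"
begin

lemma diff_F: "a \<in> F \<Longrightarrow> b \<in> F \<Longrightarrow> a - b \<in> F"
  using add_F[of a "- b"] uminus_F by simp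

lemma divide_F: "a \<in> F \<Longrightarrow> b \<in> F \<Longrightarrow> a / b \<in> F"
  by (simp add: divide_inverse mult_F inverse_F)

lemma power_F: "a \<in> F \<Longrightarrow> a ^ n \<in> F"
  by (induction n) (auto intro: one_F mult_F)

lemma sum_F: "(\<And>i. i \<in> A \<Longrightarrow> f i \<in> F) \<Longrightarrow> sum f A \<in> F"
  by (induction A rule: infinite_finite_induct) (auto intro: zero_F add_F)

lemma prod_F: "(\<And>i. i \<in> A \<Longrightarrow> f i \<in> F) \<Longrightarrow> prod f A \<in> F"
  by (induction A rule: infinite_finite_induct) (auto intro: one_F mult_F)

lemma card_F_ge_2: "card F \<ge> 2"
  using card_mono[OF fin_F, of "{0, 1}"] zero_F one_F by auto

text \<open>Multiplication by \<open>a\<close> permutes the nonzero elements, so their product does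
  not change when every factor is multiplied by \<open>a\<close>.\<close>

lemma power_card_F: "a \<in> F \<Longrightarrow> a \<noteq> 0 \<Longrightarrow> a ^ (card F - 1) = 1"
proof -
  assume a: "a \<in> F" "a \<noteq> 0"
  have "(\<lambda>x. a * x) ` (F - {0}) = F - {0}"
  proof (rule endo_inj_surj)
    show "inj_on (\<lambda>x. a * x) (F - {0})"
      using a by (auto simp: inj_on_def)
  qed (use a fin_F mult_F in auto)
  hence bij: "bij_betw (\<lambda>x. a * x) (F - {0}) (F - {0})"
    using a by (auto simp: bij_betw_def inj_on_def)
  have "(\<Prod>x\<in>F - {0}. x) = (\<Prod>x\<in>F - {0}. a * x)"
    using prod.reindex_bij_betw[OF bij, of "\<lambda>x. x"] by simp
  also have "\<dots> = a ^ (card F - 1) * (\<Prod>x\<in>F - {0}. x)"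
    by (simp add: prod.distrib zero_F)
  finally show ?thesis
    using fin_F by auto
qed

end

lemma sum_lessThan_if:
  fixes f :: "nat \<Rightarrow> 'a::comm_monoid_add"
  shows "(\<Sum>i<n. if i = j then f i else 0) = (if j < n then f j else 0)"
  by (simp)

text \<open>The locale \<open>module\<close> is not imported, since its simplification rules would orient associativity
  against \<open>mult.assoc\<close> when \<open>scale\<close> is multiplication.\<close>

locale finite_subfield_module = finite_subfield F
  for F :: "'k::field set" +
  fixes scale :: "'k \<Rightarrow> 'v::ab_group_add \<Rightarrow> 'v" (infixr "*s" 75)
  assumes module: "module scale"
begin

lemmas scale_left_distrib = module.scale_left_distrib[OF module]
lemmas scale_left_diff_distrib = module.scale_left_diff_distrib[OF module]
lemmas scale_sum_right = module.scale_sum_right[OF module]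
lemmas scale_simps = module.scale_scale[OF module] module.scale_one[OF module]
  module.scale_zero_left[OF module] module.scale_zero_right[OF module]
  module.scale_minus_left[OF module] module.scale_minus_right[OF module]

context
  notes [simp] = scale_simps
begin

definition indep :: "(nat \<Rightarrow> 'v) \<Rightarrow> nat \<Rightarrow> bool" where
  "indep v r \<longleftrightarrow> (\<forall>c. (\<forall>i<r. c i \<in> F) \<longrightarrow> (\<Sum>i<r. c i *s v i) = 0 \<longrightarrow> (\<forall>i<r. c i = 0))"

definition lspan :: "(nat \<Rightarrow> 'v) \<Rightarrow> nat \<Rightarrow> 'v set" where
  "lspan v r = {\<Sum>i<r. c i *s v i | c. \<forall>i<r. c i \<in> F}"

definition lin_closed :: "'v set \<Rightarrow> bool" where
  "lin_closed W \<longleftrightarrow> 0 \<in> W \<and> (\<forall>x\<in>W. \<forall>y\<in>W. x + y \<in> W) \<and> (\<forall>a\<in>F. \<forall>x\<in>W. a *s x \<in> W)"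

lemma lin_closed_add: "lin_closed W \<Longrightarrow> x \<in> W \<Longrightarrow> y \<in> W \<Longrightarrow> x + y \<in> W"
  and lin_closed_scale: "lin_closed W \<Longrightarrow> a \<in> F \<Longrightarrow> x \<in> W \<Longrightarrow> a *s x \<in> W"
  and lin_closed_zero: "lin_closed W \<Longrightarrow> 0 \<in> W"
  by (auto simp: lin_closed_def)

lemma lin_closed_uminus: "lin_closed W \<Longrightarrow> x \<in> W \<Longrightarrow> - x \<in> W"
  using lin_closed_scale[of W "-1" x] uminus_F[OF one_F] by simp

lemma lin_closed_diff: "lin_closed W \<Longrightarrow> x \<in> W \<Longrightarrow> y \<in> W \<Longrightarrow> x - y \<in> W"
  using lin_closed_add[of W x "- y"] lin_closed_uminus by simp

lemma lin_closed_sum: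
  "lin_closed W \<Longrightarrow> (\<And>i. i \<in> A \<Longrightarrow> f i \<in> W) \<Longrightarrow> sum f A \<in> W"
  by (induction A rule: infinite_finite_induct) (auto intro: lin_closed_zero lin_closed_add)

lemma lspan_subset: "lin_closed W \<Longrightarrow> (\<And>i. i < r \<Longrightarrow> v i \<in> W) \<Longrightarrow> lspan v r \<subseteq> W"
  by (auto simp: lspan_def intro!: lin_closed_sum lin_closed_scale)

lemma lspanI: "(\<And>i. i < r \<Longrightarrow> c i \<in> F) \<Longrightarrow> (\<Sum>i<r. c i *s v i) \<in> lspan v r"
  by (auto simp: lspan_def)

lemma lin_closed_lspan: "lin_closed (lspan v r)"
  unfolding lin_closed_def
proof (intro conjI ballI)
  show "0 \<in> lspan v r"
    using lspanI[of r "\<lambda>_. 0" v] by (simp add: zero_F)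
next
  fix x y assume "x \<in> lspan v r" "y \<in> lspan v r"
  then obtain c d where "x = (\<Sum>i<r. c i *s v i)" "y = (\<Sum>i<r. d i *s v i)"
    and "\<And>i. i < r \<Longrightarrow> c i \<in> F" "\<And>i. i < r \<Longrightarrow> d i \<in> F"
    by (auto simp: lspan_def)
  thus "x + y \<in> lspan v r"
    using lspanI[of r "\<lambda>i. c i + d i" v] by (simp add: scale_left_distrib sum.distrib add_F)
next
  fix a x assume "a \<in> F" "x \<in> lspan v r"
  then obtain c where "x = (\<Sum>i<r. c i *s v i)" "\<And>i. i < r \<Longrightarrow> c i \<in> F"
    by (auto simp: lspan_def)
  thus "a *s x \<in> lspan v r"
    using lspanI[of r "\<lambda>i. a * c i" v] \<open>a \<in> F\<close> by (simp add: scale_sum_right mult_F)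
qed

lemma in_lspan: "i < r \<Longrightarrow> v i \<in> lspan v r"
  using lspanI[of r "\<lambda>j. if j = i then 1 else 0" v]
  by (auto simp: zero_F one_F if_distrib[of "\<lambda>c. c *s _"] sum_lessThan_if cong: if_cong)

lemma lspan_PiE: "lspan v r = (\<lambda>c. \<Sum>i<r. c i *s v i) ` ({..<r} \<rightarrow>\<^sub>E F)"
proof
  show "lspan v r \<subseteq> (\<lambda>c. \<Sum>i<r. c i *s v i) ` ({..<r} \<rightarrow>\<^sub>E F)"
  proof
    fix x assume "x \<in> lspan v r"
    then obtain c where "x = (\<Sum>i<r. c i *s v i)" "\<And>i. i < r \<Longrightarrow> c i \<in> F"
      by (auto simp: lspan_def)
    thus "x \<in> (\<lambda>c. \<Sum>i<r. c i *s v i) ` ({..<r} \<rightarrow>\<^sub>E F)"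
      by (intro image_eqI[of _ _ "restrict c {..<r}"]) auto
  qed
qed (auto intro!: lspanI)

lemma indepD:
  assumes "indep v r" "\<And>i. i < r \<Longrightarrow> c i \<in> F" "(\<Sum>i<r. c i *s v i) = 0" "i < r"
  shows "c i = 0"
proof -
  have c: "\<forall>i<r. c i \<in> F" using assms(2) by blast
  show ?thesis
    using assms(1)[unfolded indep_def, THEN spec, THEN mp, OF c, THEN mp, OF assms(3)] assms(4) by blast
qed

lemma indep_unique:
  assumes "indep v r" "\<And>i. i < r \<Longrightarrow> c i \<in> F" "\<And>i. i < r \<Longrightarrow> d i \<in> F"
    and "(\<Sum>i<r. c i *s v i) = (\<Sum>i<r. d i *s v i)" "i < r"
  shows "c i = d i"
proof -
  have 1: "(\<Sum>i<r. (c i - d i) *s v i) = 0"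
    using assms(4) by (simp add: scale_left_diff_distrib sum_subtractf)
  have "c i - d i = 0"
    by (rule indepD[OF assms(1) _ 1 assms(5)]) (use assms(2,3) in \<open>auto intro: diff_F\<close>)
  thus ?thesis by simp
qed

lemma indep_inj_on: "indep v r \<Longrightarrow> inj_on (\<lambda>c. \<Sum>i<r. c i *s v i) ({..<r} \<rightarrow>\<^sub>E F)"
proof (rule inj_onI)
  fix c d assume *: "indep v r" "c \<in> {..<r} \<rightarrow>\<^sub>E F" "d \<in> {..<r} \<rightarrow>\<^sub>E F"
    "(\<Sum>i<r. c i *s v i) = (\<Sum>i<r. d i *s v i)"
  show "c = d"
  proof (rule PiE_ext[OF *(2,3)])
    fix i assume "i \<in> {..<r}"
    hence i: "i < r" by simp
    show "c i = d i" by (rule indep_unique[OF *(1) _ _ *(4) i]) (use *(2,3) in auto)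
  qed
qed

lemma card_lspan: "indep v r \<Longrightarrow> card (lspan v r) = card F ^ r"
  by (simp add: lspan_PiE card_image indep_inj_on card_PiE)

lemma finite_lspan: "finite (lspan v r)"
  by (simp add: lspan_PiE fin_F finite_PiE)

lemma indep_snoc:
  assumes "indep v r" "w \<notin> lspan v r"
  shows "indep (v(r := w)) (Suc r)"
  unfolding indep_def
proof (intro allI impI)
  fix c i
  assume c: "\<forall>i<Suc r. c i \<in> F" and z: "(\<Sum>i<Suc r. c i *s (v(r := w)) i) = 0" and i: "i < Suc r"
  have e: "(\<Sum>i<r. c i *s v i) + c r *s w = 0" using z by simp
  have r0: "c r = 0"
  proof (rule ccontr)
    assume nz: "c r \<noteq> 0"
    have "(\<Sum>i<r. c i *s v i) \<in> lspan v r" using c by (intro lspanI) auto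
    hence "- inverse (c r) *s (\<Sum>i<r. c i *s v i) \<in> lspan v r"
      using c by (intro lin_closed_scale[OF lin_closed_lspan]) (auto intro: uminus_F inverse_F)
    also have "(\<Sum>i<r. c i *s v i) = - (c r *s w)" using e by (simp add: eq_neg_iff_add_eq_0)
    also have "- inverse (c r) *s (- (c r *s w)) = w" using nz by simp
    finally show False using assms by simp
  qed
  have "(\<Sum>i<r. c i *s v i) = 0" using e r0 by simp
  hence "c i = 0" if "i < r" for i
    using c that by (intro indepD[OF assms(1)]) auto
  thus "c i = 0" using i r0 by (auto simp: less_Suc_eq)
qed

lemma indep_0: "indep v 0"
  by (simp add: indep_def)

text \<open>Cardinality replaces dimension: \<open>n\<close> independent vectors span only
  \<open>card F ^ n\<close> elements, too few to fill \<open>W\<close> while \<open>n < r\<close>,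
  so a further vector always exists.\<close>

lemma indep_extend:
  assumes "lin_closed W" "finite W" "indep v s" "\<And>i. i < s \<Longrightarrow> v i \<in> W"
    and "s \<le> r" "card F ^ r \<le> card W"
  shows "\<exists>v'. (\<forall>i<s. v' i = v i) \<and> indep v' r \<and> (\<forall>i<r. v' i \<in> W)"
  using \<open>s \<le> r\<close> \<open>card F ^ r \<le> card W\<close>
proof (induction r rule: dec_induct)
  case base
  show ?case using assms by blast
next
  case (step n)
  have lt: "card F ^ n < card F ^ Suc n" using card_F_ge_2 by simp
  hence "card F ^ n \<le> card W" using step.prems by linarith
  then obtain v' where v': "\<forall>i<s. v' i = v i" "indep v' n" "\<forall>i<n. v' i \<in> W"
    using step.IH by blast
  have "card (lspan v' n) < card W"
    using lt step.prems card_lspan[OF v'(2)] by linarith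
  hence "\<not> W \<subseteq> lspan v' n" using card_mono[OF finite_lspan] by (meson not_le)
  then obtain w where w: "w \<in> W" "w \<notin> lspan v' n" by blast
  have "indep (v'(n := w)) (Suc n)" using v' w by (intro indep_snoc)
  moreover have "\<forall>i<s. (v'(n := w)) i = v i" "\<forall>i<Suc n. (v'(n := w)) i \<in> W"
    using v' w step.hyps by (auto simp: less_Suc_eq)
  ultimately show ?case by blast
qed

lemma lspan_eq:
  assumes "lin_closed W" "finite W" "indep v r" "\<And>i. i < r \<Longrightarrow> v i \<in> W" "card W = card F ^ r"
  shows "lspan v r = W"
  using assms lspan_subset by (intro card_subset_eq) (auto simp: card_lspan)

text \<open>The diagonalisation prepends each vector with \<open>Q w \<noteq> 0\<close>, so that
  these come before the vectors on which \<open>Q\<close> vanishes; hence a version of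
  \<open>indep_snoc\<close> with the new vector in front.\<close>

lemma indep_Suc_shift:
  assumes "indep v r" "w \<notin> lspan v r"
  shows "indep (case_nat w v) (Suc r)"
  unfolding indep_def
proof (intro allI impI)
  fix c i
  assume c: "\<forall>i<Suc r. c i \<in> F" and z: "(\<Sum>i<Suc r. c i *s case_nat w v i) = 0" and i: "i < Suc r"
  \<comment> \<open>The coefficients are rotated so that the one of \<open>w\<close> comes last, as
    in \<open>indep_snoc\<close>.\<close>
  define d where "d i = (if i < r then c (Suc i) else c 0)" for i
  have "(\<Sum>i<Suc r. d i *s (v(r := w)) i) = (\<Sum>i<r. c (Suc i) *s v i) + c 0 *s w"
    by (simp add: d_def)
  also have "\<dots> = 0" using z by (subst (asm) sum.lessThan_Suc_shift) (simp add: add.commute)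
  finally have "(\<Sum>i<Suc r. d i *s (v(r := w)) i) = 0" .
  hence d0: "d i = 0" if "i < Suc r" for i
    using c that by (intro indepD[OF indep_snoc[OF assms]]) (auto simp: d_def)
  have "c 0 = 0" using d0[of r] by (simp add: d_def)
  moreover have "c (Suc i) = 0" if "i < r" for i
    using d0[of i] that by (simp add: d_def)
  ultimately have "c 0 = 0" "\<And>i. i < r \<Longrightarrow> c (Suc i) = 0" by auto
  thus "c i = 0" using i by (cases i) auto
qed

end

end

section \<open>Fibres of additive maps and of linear functionals\<close>

lemma additive_on_group:
  fixes \<phi> :: "'v::ab_group_add \<Rightarrow> 'w::ab_group_add"
  assumes sub: "\<And>x y. x \<in> W \<Longrightarrow> y \<in> W \<Longrightarrow> x - y \<in> W"
    and diff: "\<And>x y. x \<in> W \<Longrightarrow> y \<in> W \<Longrightarrow> \<phi> (x - y) = \<phi> x - \<phi> y"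
    and xy: "x \<in> W" "y \<in> W"
  shows "x + y \<in> W" "\<phi> (x + y) = \<phi> x + \<phi> y"
proof -
  have z: "0 \<in> W" using sub[OF xy(1) xy(1)] by simp
  have m: "- y \<in> W" using sub[OF z xy(2)] by simp
  have "\<phi> 0 = 0" using diff[OF z z] by simp
  hence "\<phi> (- y) = - \<phi> y" using diff[OF z xy(2)] by simp
  thus "x + y \<in> W" "\<phi> (x + y) = \<phi> x + \<phi> y" using sub[OF xy(1) m] diff[OF xy(1) m] by simp_all
qed

text \<open>Translation by a preimage of \<open>z\<close> matches its fibre with the kernel.\<close>

lemma card_additive_fibre:
  fixes \<phi> :: "'v::ab_group_add \<Rightarrow> 'w::ab_group_add"
  assumes sub: "\<And>x y. x \<in> W \<Longrightarrow> y \<in> W \<Longrightarrow> x - y \<in> W"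
    and diff: "\<And>x y. x \<in> W \<Longrightarrow> y \<in> W \<Longrightarrow> \<phi> (x - y) = \<phi> x - \<phi> y"
    and z: "z \<in> \<phi> ` W"
  shows "card {w\<in>W. \<phi> w = z} = card {w\<in>W. \<phi> w = 0}"
proof -
  obtain u where u: "u \<in> W" "z = \<phi> u" using z by auto
  have "bij_betw (\<lambda>w. w - u) {w\<in>W. \<phi> w = z} {w\<in>W. \<phi> w = 0}"
  proof (rule bij_betwI[where g = "\<lambda>w. w + u"])
    show "(\<lambda>w. w - u) \<in> {w\<in>W. \<phi> w = z} \<rightarrow> {w\<in>W. \<phi> w = 0}"
      using u sub diff by auto
    show "(\<lambda>w. w + u) \<in> {w\<in>W. \<phi> w = 0} \<rightarrow> {w\<in>W. \<phi> w = z}"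
      using u additive_on_group[OF sub diff] by auto
  qed auto
  thus ?thesis by (rule bij_betw_same_card)
qed

lemma card_eq_sum_fibres:
  assumes "finite A" "finite B" "f ` A \<subseteq> B"
  shows "card A = (\<Sum>z\<in>B. card {a\<in>A. f a = z})"
  using sum.group[OF assms, of "\<lambda>_. 1::nat"] by simp

lemma card_additive_image:
  fixes \<phi> :: "'v::ab_group_add \<Rightarrow> 'w::ab_group_add"
  assumes fin: "finite W" and sub: "\<And>x y. x \<in> W \<Longrightarrow> y \<in> W \<Longrightarrow> x - y \<in> W"
    and diff: "\<And>x y. x \<in> W \<Longrightarrow> y \<in> W \<Longrightarrow> \<phi> (x - y) = \<phi> x - \<phi> y"
  shows "card W = card (\<phi> ` W) * card {w\<in>W. \<phi> w = 0}"
proof -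
  have "card W = (\<Sum>z\<in>\<phi> ` W. card {w\<in>W. \<phi> w = z})"
    using fin by (intro card_eq_sum_fibres) auto
  also have "\<dots> = (\<Sum>z\<in>\<phi> ` W. card {w\<in>W. \<phi> w = 0})"
    by (intro sum.cong refl card_additive_fibre[OF sub diff])
  finally show ?thesis by simp
qed

context finite_subfield_module
begin

context
  notes [simp] = scale_simps
begin

text \<open>The multiples of one nonzero value \<open>\<phi> w\<close> exhaust \<open>F\<close>, so
  \<open>\<phi>\<close> is onto and all its fibres have the size of its kernel. This
  equidistribution does the work of the orthogonality of characters.\<close>

lemma card_functional_fibre:
  assumes W: "lin_closed W" "finite W"
    and diff: "\<And>x y. x \<in> W \<Longrightarrow> y \<in> W \<Longrightarrow> \<phi> (x - y) = \<phi> x - \<phi> y"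
    and scale: "\<And>a x. a \<in> F \<Longrightarrow> x \<in> W \<Longrightarrow> \<phi> (a *s x) = a * \<phi> x"
    and mem: "\<And>x. x \<in> W \<Longrightarrow> \<phi> x \<in> F"
    and nz: "w \<in> W" "\<phi> w \<noteq> 0" and c: "c \<in> F"
  shows "card F * card {x\<in>W. \<phi> x = c} = card W"
proof -
  have im: "\<phi> ` W = F"
  proof
    show "\<phi> ` W \<subseteq> F" using mem by blast
    show "F \<subseteq> \<phi> ` W"
    proof
      fix d assume "d \<in> F"
      hence "d / \<phi> w \<in> F" using mem[OF nz(1)] by (rule divide_F)
      hence "\<phi> ((d / \<phi> w) *s w) = d" "(d / \<phi> w) *s w \<in> W"
        using nz W(1) by (auto simp: scale lin_closed_scale)
      thus "d \<in> \<phi> ` W" by (metis image_eqI)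
    qed
  qed
  have "card {x\<in>W. \<phi> x = c} = card {x\<in>W. \<phi> x = 0}"
    by (rule card_additive_fibre[OF lin_closed_diff[OF W(1)] diff]) (use c im in auto)
  thus ?thesis
    using card_additive_image[OF W(2) lin_closed_diff[OF W(1)] diff] im by simp
qed

text \<open>A basis of \<open>U\<close> is cut short or extended, which gives an
  \<open>r\<close>-dimensional subspace comparable with \<open>U\<close>. Taking for
  \<open>U\<close> either factor of \<open>Fq \<times> L\<close> produces the extremal
  subcodes.\<close>

lemma indep_adapted:
  assumes U: "lin_closed U" "U \<subseteq> V" "card U = card F ^ u"
    and V: "lin_closed V" "finite V" "card F ^ r \<le> card V"
  shows "\<exists>v. indep v r \<and> (\<forall>i<r. v i \<in> V) \<and> (r \<le> u \<longrightarrow> lspan v r \<subseteq> U) \<and> (u \<le> r \<longrightarrow> U \<subseteq> lspan v r)"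
proof -
  have finU: "finite U" using U V finite_subset by blast
  have F0: "card F > 0" using card_F_ge_2 by simp
  have ex: "\<exists>v. indep v k \<and> (\<forall>i<k. v i \<in> U)" if "k \<le> u" for k
    using indep_extend[OF U(1) finU indep_0, of "\<lambda>_. 0" k] U(3) power_increasing[OF that, of "card F"] F0
    by auto
  show ?thesis
  proof (cases "r < u")
    case True
    then obtain v where "indep v r" "\<forall>i<r. v i \<in> U" using ex[of r] by auto
    thus ?thesis using True U lspan_subset[OF U(1), of r v] by (intro exI[of _ v]) auto
  next
    case False
    obtain v where v: "indep v u" "\<forall>i<u. v i \<in> U" using ex[of u] by auto
    have span: "lspan v u = U" using v U finU by (intro lspan_eq) auto
    obtain v' where v': "\<forall>i<u. v' i = v i" "indep v' r" "\<forall>i<r. v' i \<in> V"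
      using indep_extend[OF V(1,2) v(1) _ _ V(3)] v(2) U(2) False by (meson not_le subsetD)
    have "v i \<in> lspan v' r" if "i < u" for i
      using v'(1) False in_lspan[of i r v'] that by simp
    hence "lspan v u \<subseteq> lspan v' r" by (rule lspan_subset[OF lin_closed_lspan])
    moreover have "lspan v' r \<subseteq> U" if "r \<le> u"
      using that False v v' by (intro lspan_subset[OF U(1)]) auto
    ultimately show ?thesis using v' span by blast
  qed
qed

end

end

section \<open>Finite fields and traces\<close>

lemma card_power_roots_le:
  fixes c :: "'k::field"
  assumes "n > 0"
  shows "finite {x. x ^ n = c}" "card {x. x ^ n = c} \<le> n"
proof -
  define P where "P = monom 1 n - [:c:]"
  have deg: "degree P = n"
    unfolding P_def using assms
    by (subst diff_conv_add_uminus, subst degree_add_eq_left) (auto simp: degree_monom_eq)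
  have ne: "P \<noteq> 0" using deg assms by auto
  have eq: "{x. poly P x = 0} = {x. x ^ n = c}"
    by (auto simp: P_def poly_monom)
  show "finite {x. x ^ n = c}" "card {x. x ^ n = c} \<le> n"
    using card_poly_roots_bound[OF ne] poly_roots_finite[OF ne] deg eq by auto
qed

lemma degree_sum_powers:
  assumes "(q::nat) \<ge> 2"
  shows "degree (\<Sum>i<Suc n. monom (1::'k::field) (q ^ i)) = q ^ n"
proof (induction n)
  case (Suc n)
  have "degree (\<Sum>i<Suc n. monom (1::'k) (q ^ i)) < degree (monom (1::'k) (q ^ Suc n))"
    using Suc assms by (simp add: degree_monom_eq)
  thus ?case
    by (subst sum.lessThan_Suc, subst degree_add_eq_right) (simp_all add: degree_monom_eq)
qed (simp add: degree_monom_eq)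

locale prime_char =
  fixes p :: nat and ty :: "'k::field itself"
  assumes prime_p: "prime p" and of_nat_p: "of_nat p = (0 :: 'k)"
begin

lemma CHAR_eq_p: "CHAR('k) = p"
proof -
  have "CHAR('k) dvd p" using of_nat_p of_nat_eq_0_iff_char_dvd by blast
  moreover have "CHAR('k) \<noteq> 1" by (metis of_nat_CHAR of_nat_1 one_neq_zero)
  ultimately show ?thesis using prime_p by (auto simp: prime_nat_iff)
qed

lemma p_ge_2: "p \<ge> 2"
  using prime_p prime_ge_2_nat by blast

lemma frobenius_add: "(x + y :: 'k) ^ (p ^ n) = x ^ (p ^ n) + y ^ (p ^ n)"
  by (rule freshmans_dream') (simp_all add: CHAR_eq_p prime_p)

lemma frobenius_sum: "(sum f A :: 'k) ^ (p ^ n) = (\<Sum>i\<in>A. f i ^ (p ^ n))"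
  by (rule freshmans_dream_sum') (simp_all add: CHAR_eq_p prime_p)

lemma frobenius_uminus: "(- x :: 'k) ^ (p ^ n) = - (x ^ (p ^ n))"
  using frobenius_add[of x "- x" n] p_ge_2 by (simp add: power_0_left eq_neg_iff_add_eq_0 add.commute)

lemma frobenius_diff: "(x - y :: 'k) ^ (p ^ n) = x ^ (p ^ n) - y ^ (p ^ n)"
  using frobenius_add[of x "- y" n] by (simp add: frobenius_uminus)

lemma p_power_ge_2: "e \<ge> 1 \<Longrightarrow> p ^ e \<ge> 2"
  using p_ge_2 power_increasing[of 1 e p] by simp

text \<open>Only an upper bound holds in general: the ambient field need not contain all roots of
  X^(p^e) - X.\<close>

lemma card_Fsub_le:
  assumes "e \<ge> 1"
  shows "finite (Fsub p e :: 'k set)" "card (Fsub p e :: 'k set) \<le> p ^ e"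
proof -
  define P where "P = monom (1::'k) (p ^ e) - monom 1 1"
  have deg: "degree P = p ^ e"
    unfolding P_def using p_power_ge_2[OF assms]
    by (subst diff_conv_add_uminus, subst degree_add_eq_left) (auto simp: degree_monom_eq)
  hence "degree P \<noteq> 0" using p_power_ge_2[OF assms] by linarith
  hence ne: "P \<noteq> 0" by (metis degree_0)
  have eq: "{x. poly P x = 0} = Fsub p e"
    by (auto simp: P_def poly_monom Fsub_def)
  show "finite (Fsub p e :: 'k set)" "card (Fsub p e :: 'k set) \<le> p ^ e"
    using card_poly_roots_bound[OF ne] poly_roots_finite[OF ne] deg eq by auto
qed

lemma finite_subfield_Fsub: "e \<ge> 1 \<Longrightarrow> finite_subfield (Fsub p e :: 'k set)"
  using p_ge_2 card_Fsub_le(1)[of e]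
  by unfold_locales
    (auto simp: Fsub_def frobenius_add frobenius_uminus power_mult_distrib power_inverse)

lemma Fsub_power_power: "(x::'k) \<in> Fsub p e \<Longrightarrow> x ^ ((p ^ e) ^ i) = x"
  by (induction i) (auto simp: Fsub_def power_mult)

lemma Fsub_mono: "Fsub p e \<subseteq> (Fsub p (e * s) :: 'k set)"
  using Fsub_power_power[of _ e s] by (auto simp: Fsub_def power_mult)

lemma trace_add: "trace p e s (x + y :: 'k) = trace p e s x + trace p e s y"
  by (simp add: trace_def frobenius_add sum.distrib flip: power_mult)

lemma trace_diff: "trace p e s (x - y :: 'k) = trace p e s x - trace p e s y"
  by (simp add: trace_def frobenius_diff sum_subtractf flip: power_mult)

lemma trace_scale: "(c::'k) \<in> Fsub p e \<Longrightarrow> trace p e s (c * x) = c * trace p e s x"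
  by (simp add: trace_def power_mult_distrib Fsub_power_power sum_distrib_left)

lemma trace_0: "trace p e s (0 :: 'k) = 0"
  using trace_diff[of e s 0 0] by simp

text \<open>The sum telescopes, and its two ends agree because \<open>x\<close> lies in
  \<open>Fsub p (e * s)\<close>.\<close>

lemma trace_frobenius_diff:
  assumes "(x::'k) \<in> Fsub p (e * s)"
  shows "trace p e s (x ^ (p ^ e) - x) = 0"
proof -
  have "trace p e s (x ^ (p ^ e) - x) = (\<Sum>i<s. x ^ ((p ^ e) ^ Suc i) - x ^ ((p ^ e) ^ i))"
    unfolding trace_diff by (simp add: trace_def sum_subtractf flip: power_mult)
  also have "\<dots> = x ^ ((p ^ e) ^ s) - x ^ ((p ^ e) ^ 0)"
    by (rule sum_lessThan_telescope)
  also have "\<dots> = 0" using assms by (simp add: Fsub_def power_mult)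
  finally show ?thesis .
qed

lemma trace_in_Fsub:
  assumes "(x::'k) \<in> Fsub p (e * s)"
  shows "trace p e s x \<in> Fsub p e"
proof -
  have "trace p e s x ^ (p ^ e) = trace p e s (x ^ (p ^ e))"
    by (simp add: trace_def frobenius_sum mult.commute flip: power_mult)
  thus ?thesis
    using trace_frobenius_diff[OF assms] unfolding trace_diff by (simp add: Fsub_def)
qed

text \<open>The trace is a polynomial of degree (p^e)^(s - 1), which bounds its zeros in the whole
  ambient field.\<close>

lemma card_trace_zero_le:
  assumes "e \<ge> 1" "s \<ge> 1"
  shows "finite {x::'k. trace p e s x = 0}" "card {x::'k. trace p e s x = 0} \<le> (p ^ e) ^ (s - 1)"
proof -
  define P where "P = (\<Sum>i<s. monom (1::'k) ((p ^ e) ^ i))"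
  have deg: "degree P = (p ^ e) ^ (s - 1)"
    using degree_sum_powers[OF p_power_ge_2[OF assms(1)], of "s - 1"] assms(2) by (simp add: P_def)
  hence ne: "P \<noteq> 0" using p_ge_2 by auto
  have eq: "{x. poly P x = 0} = {x. trace p e s x = 0}"
    by (auto simp: P_def trace_def poly_sum poly_monom)
  show "finite {x::'k. trace p e s x = 0}" "card {x::'k. trace p e s x = 0} \<le> (p ^ e) ^ (s - 1)"
    using card_poly_roots_bound[OF ne] poly_roots_finite[OF ne] deg eq by auto
qed

lemma trace_nonzero:
  assumes "e \<ge> 1" "s \<ge> 1" "card (Fsub p (e * s) :: 'k set) = p ^ (e * s)"
  shows "\<exists>x\<in>Fsub p (e * s) :: 'k set. trace p e s x \<noteq> 0"
proof (rule ccontr)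
  assume "\<not> ?thesis"
  hence "(Fsub p (e * s) :: 'k set) \<subseteq> {x. trace p e s x = 0}" by auto
  hence "card (Fsub p (e * s) :: 'k set) \<le> card {x::'k. trace p e s x = 0}"
    by (rule card_mono[OF card_trace_zero_le(1)[OF assms(1,2)]])
  hence "p ^ (e * s) \<le> (p ^ e) ^ (s - 1)"
    using card_trace_zero_le(2)[OF assms(1,2)] assms(3) by linarith
  moreover have "(p ^ e) ^ (s - 1) < (p ^ e) ^ s"
    using p_power_ge_2[OF assms(1)] assms(2) by (intro power_strict_increasing) auto
  ultimately show False by (simp add: power_mult)
qed

text \<open>The image of \<open>x \<mapsto> x\<^sup>q - x\<close> lies in the kernel of the trace, which is small; hence its
  kernel, the subfield of order \<open>q\<close>, is large.\<close>

lemma card_Fsub_subfield: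
  assumes "e \<ge> 1" "s \<ge> 1" "card (Fsub p (e * s) :: 'k set) = p ^ (e * s)"
  shows "card (Fsub p e :: 'k set) = p ^ e"
proof (rule antisym)
  let ?W = "Fsub p (e * s) :: 'k set" and ?\<phi> = "\<lambda>x::'k. x ^ (p ^ e) - x"
  have es: "e * s \<ge> 1" using assms by (simp add: Suc_leI)
  interpret W: finite_subfield ?W by (rule finite_subfield_Fsub[OF es])
  have "p ^ (e * s) = card (?\<phi> ` ?W) * card {w\<in>?W. ?\<phi> w = 0}"
    unfolding assms(3)[symmetric]
    by (rule card_additive_image) (auto simp: W.fin_F W.diff_F frobenius_diff)
  also have "card (?\<phi> ` ?W) \<le> (p ^ e) ^ (s - 1)"
  proof -
    have "?\<phi> ` ?W \<subseteq> {x. trace p e s x = 0}" using trace_frobenius_diff by auto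
    thus ?thesis
      using card_mono[OF card_trace_zero_le(1)[OF assms(1,2)]] card_trace_zero_le(2)[OF assms(1,2)]
        order_trans by blast
  qed
  also have "card {w\<in>?W. ?\<phi> w = 0} \<le> card (Fsub p e :: 'k set)"
    by (intro card_mono card_Fsub_le(1)[OF assms(1)]) (auto simp: Fsub_def)
  also have "p ^ (e * s) = (p ^ e) ^ (s - 1) * p ^ e"
    using assms(2) by (cases s) (simp_all add: power_add power_mult)
  finally show "p ^ e \<le> card (Fsub p e :: 'k set)"
    using p_ge_2 by simp
qed (rule card_Fsub_le(2)[OF assms(1)])

end

section \<open>The quadratic character\<close>

locale odd_prime_char = prime_char p ty for p and ty :: "'k::field itself" +
  fixes m :: nat
  assumes odd_p: "odd p" and m_ge_1: "m \<ge> 1" and card_Fq: "card (Fsub p m :: 'k set) = p ^ m"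
begin

abbreviation Fq :: "'k set" where "Fq \<equiv> Fsub p m"
abbreviation q :: nat where "q \<equiv> p ^ m"

sublocale Fq: finite_subfield Fq
  by (rule finite_subfield_Fsub[OF m_ge_1])

lemma q_ge_2: "q \<ge> 2"
  by (rule p_power_ge_2[OF m_ge_1])

lemma odd_q: "odd q"
  using odd_p by simp

lemma two_neq_0: "(2::'k) \<noteq> 0"
proof
  assume "(2::'k) = 0"
  hence "of_nat 2 = (0::'k)" by simp
  hence "p dvd 2" using of_nat_eq_0_iff_char_dvd[where 'a = 'k] CHAR_eq_p by metis
  hence "p = 2" using p_ge_2 dvd_imp_le[of p 2] by linarith
  thus False using odd_p by simp
qed

lemma one_neq_minus_one: "(1::'k) \<noteq> - 1"
  using two_neq_0 by (metis add.right_inverse one_add_one)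

lemma two_in_Fq: "2 \<in> Fq"
  using Fq.add_F[OF Fq.one_F Fq.one_F] by simp

lemma card_sqrt:
  assumes "x \<in> Fq"
  shows "int (card {y\<in>Fq. y\<^sup>2 = x}) = 1 + eta p m x"
proof (cases "x = 0")
  case True
  hence "{y\<in>Fq. y\<^sup>2 = x} = {0}" using Fq.zero_F by auto
  thus ?thesis using True by (simp add: eta_def)
next
  case nz: False
  show ?thesis
  proof (cases "\<exists>y\<in>Fq. y\<^sup>2 = x")
    case True
    then obtain y where y: "y \<in> Fq" "y\<^sup>2 = x" by blast
    have "{z\<in>Fq. z\<^sup>2 = x} = {y, - y}"
      using y Fq.uminus_F by (auto simp: power2_eq_iff)
    moreover have "y \<noteq> - y"
    proof
      assume "y = - y"
      hence "2 * y = 0" by (metis add.right_inverse mult_2)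
      thus False using two_neq_0 y nz by auto
    qed
    ultimately have "card {z\<in>Fq. z\<^sup>2 = x} = 2" by simp
    thus ?thesis using True nz by (simp add: eta_def)
  next
    case False
    hence "{y\<in>Fq. y\<^sup>2 = x} = {}" by auto
    hence "card {y\<in>Fq. y\<^sup>2 = x} = 0" by (simp only: card.empty)
    thus ?thesis using False nz by (simp add: eta_def)
  qed
qed

text \<open>The nonzero squares are roots of X^h - 1 with h = (q - 1)/2. No element has more than
  two square roots, so there are at least h squares and they exhaust the roots; for any other
  nonzero x the power x^h is -1.\<close>

lemma euler_criterion:
  assumes "x \<in> Fq"
  shows "of_int (eta p m x) = x ^ ((q - 1) div 2)"
proof -
  let ?h = "(q - 1) div 2" and ?S = "(\<lambda>y. y\<^sup>2) ` (Fq - {0})"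
  have h: "2 * ?h = q - 1" using odd_q by auto
  have hpos: "?h > 0" using h q_ge_2 by linarith
  have sub: "?S \<subseteq> {x. x ^ ?h = 1}"
  proof safe
    fix y assume "y \<in> Fq" "y \<noteq> 0"
    thus "(y\<^sup>2) ^ ?h = 1"
      using Fq.power_card_F[of y] h by (simp add: card_Fq flip: power_mult)
  qed
  have "q - 1 = card (\<Union>x\<in>?S. {y\<in>Fq. y\<^sup>2 = x})"
  proof -
    have "(\<Union>x\<in>?S. {y\<in>Fq. y\<^sup>2 = x}) = Fq - {0}" by auto
    thus ?thesis using card_Fq Fq.zero_F by simp
  qed
  also have "\<dots> \<le> (\<Sum>x\<in>?S. card {y\<in>Fq. y\<^sup>2 = x})"
    by (rule card_UN_le) (simp add: Fq.fin_F)
  also have "\<dots> \<le> (\<Sum>x\<in>?S. 2)"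
  proof (rule sum_mono)
    fix x assume "x \<in> ?S"
    hence "x \<in> Fq" using Fq.power_F by auto
    hence "int (card {y\<in>Fq. y\<^sup>2 = x}) = 1 + eta p m x" by (rule card_sqrt)
    moreover have "eta p m x \<le> 1" by (simp add: eta_def)
    ultimately show "card {y\<in>Fq. y\<^sup>2 = x} \<le> 2" by linarith
  qed
  finally have "?h \<le> card ?S" using h by simp
  hence S: "?S = {x. x ^ ?h = 1}"
    using card_power_roots_le[OF hpos, of "1::'k"] sub by (intro card_seteq) auto
  show ?thesis
  proof (cases "x = 0")
    case True
    thus ?thesis using hpos by (simp add: eta_def)
  next
    case nz: False
    have "(x ^ ?h)\<^sup>2 = 1"
      using Fq.power_card_F[OF assms nz] h by (simp add: card_Fq mult.commute flip: power_mult)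
    hence pm: "x ^ ?h = 1 \<or> x ^ ?h = - 1" by (simp add: power2_eq_1_iff)
    have "(\<exists>y\<in>Fq. y\<^sup>2 = x) \<longleftrightarrow> x \<in> ?S" using nz by auto
    hence "(\<exists>y\<in>Fq. y\<^sup>2 = x) \<longleftrightarrow> x ^ ?h = 1" unfolding S by simp
    thus ?thesis using pm nz one_neq_minus_one by (auto simp: eta_def)
  qed
qed

lemma eta_cases: "eta p m x \<in> {- 1, 0, 1}"
  by (auto simp: eta_def)

text \<open>\<open>eta\<close> is integer-valued while Euler's criterion lives in the field; the
  values -1, 0, 1 stay distinct there because the characteristic is odd.\<close>

lemma eta_eqI:
  assumes "a \<in> {- 1, 0, 1}" "b \<in> {- 1, 0, 1}" "of_int a = (of_int b :: 'k)"
  shows "a = b"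
  using assms one_neq_minus_one by auto

lemma eta_mult: "x \<in> Fq \<Longrightarrow> y \<in> Fq \<Longrightarrow> eta p m (x * y) = eta p m x * eta p m y"
  using eta_cases[of x] eta_cases[of y]
  by (intro eta_eqI[OF eta_cases]) (auto simp: euler_criterion Fq.mult_F power_mult_distrib)

lemma eta_1: "eta p m (1::'k) = 1"
  using Fq.one_F by (auto simp: eta_def intro!: bexI[of _ 1])

lemma eta_power: "x \<in> Fq \<Longrightarrow> eta p m (x ^ n) = eta p m x ^ n"
  by (induction n) (auto simp: eta_1 eta_mult Fq.power_F)

lemma eta_square: "x \<noteq> 0 \<Longrightarrow> eta p m x * eta p m x = 1"
  by (auto simp: eta_def)

text \<open>With p = 2k + 1 and p^m = 2j + 1, multiplying by p turns j into 2kj + k + j, so j has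
  the parity of k m. This converts the exponent of Euler's criterion into the one used in
  \<open>eps_sign\<close>.\<close>

lemma half_q_parity: "even ((p ^ m - 1) div 2) \<longleftrightarrow> even ((p - 1) div 2 * m)"
proof -
  obtain k where k: "p = 2 * k + 1" using odd_p by (elim oddE)
  have "\<exists>j. p ^ m = 2 * j + 1 \<and> (even j \<longleftrightarrow> even (k * m))" for m
  proof (induction m)
    case (Suc m)
    then obtain j where j: "p ^ m = 2 * j + 1" "even j \<longleftrightarrow> even (k * m)" by blast
    have "p ^ Suc m = 2 * (2 * k * j + k + j) + 1"
      by (simp add: j(1)) (simp add: k algebra_simps)
    thus ?case using j(2) by (intro exI[of _ "2 * k * j + k + j"]) auto
  qed auto
  then obtain j where "p ^ m = 2 * j + 1" "even j \<longleftrightarrow> even (k * m)" by blast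
  thus ?thesis using k by simp
qed

lemma eta_minus_1: "eta p m (- 1 :: 'k) = (- 1) ^ ((p - 1) div 2 * m)"
proof -
  have "of_int (eta p m (- 1 :: 'k)) = (- 1 :: 'k) ^ ((q - 1) div 2)"
    by (rule euler_criterion) (simp add: Fq.uminus_F Fq.one_F)
  also have "\<dots> = of_int ((- 1) ^ ((p - 1) div 2 * m))"
    using half_q_parity by (simp add: minus_one_power_iff)
  finally show ?thesis
    by (intro eta_eqI[OF eta_cases]) (auto simp: minus_one_power_iff)
qed

end

section \<open>Counting zeros of diagonal forms\<close>

context odd_prime_char
begin

text \<open>It sums to zero over \<open>Fq\<close>. Together with \<open>eta\<close> it is closed
  under adding a variable: summing eta(c - l x^2) over x gives a multiple of bal(c), and summing
  bal(c - l x^2) a multiple of eta(c l). The two alternate, hence the role of the parity of the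
  rank.\<close>

definition bal :: "'k \<Rightarrow> int" where
  "bal c = (if c = 0 then int q - 1 else - 1)"

text \<open>Count the conic x^2 - y^2 = a twice: by \<open>card_sqrt\<close> it has q plus the
  wanted sum many points, and u = x - y, w = x + y turns it into u w = a, with 2q - 1 points for a =
  0 and q - 1 otherwise.\<close>

lemma sum_eta_shifted_square:
  assumes a: "a \<in> Fq"
  shows "(\<Sum>x\<in>Fq. eta p m (x\<^sup>2 - a)) = bal a"
proof -
  let ?A = "SIGMA x:Fq. {y\<in>Fq. y\<^sup>2 = x\<^sup>2 - a}" and ?B = "{z\<in>Fq \<times> Fq. fst z * snd z = a}"
  have "int (card ?A) = (\<Sum>x\<in>Fq. int (card {y\<in>Fq. y\<^sup>2 = x\<^sup>2 - a}))"
    by (subst card_SigmaI) (auto simp: Fq.fin_F)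
  also have "\<dots> = (\<Sum>x\<in>Fq. 1 + eta p m (x\<^sup>2 - a))"
    by (intro sum.cong refl card_sqrt Fq.diff_F Fq.power_F a)
  finally have 1: "int (card ?A) = int q + (\<Sum>x\<in>Fq. eta p m (x\<^sup>2 - a))"
    by (simp add: sum.distrib card_Fq)
  have four: "(4::'k) \<noteq> 0" using two_neq_0 by (metis mult_2 mult_eq_0_iff numeral_Bit0)
  have "bij_betw (\<lambda>(x, y). (x - y, x + y)) ?A ?B"
  proof (rule bij_betwI[where g = "\<lambda>(u, w). ((u + w) / 2, (w - u) / 2)"])
    show "(\<lambda>(x, y). (x - y, x + y)) \<in> ?A \<rightarrow> ?B"
      by (auto simp: Fq.diff_F Fq.add_F algebra_simps power2_eq_square)
    show "(\<lambda>(u, w). ((u + w) / 2, (w - u) / 2)) \<in> ?B \<rightarrow> ?A"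
      using two_neq_0 four
      by (auto simp: Fq.diff_F Fq.add_F Fq.divide_F two_in_Fq field_simps power2_eq_square)
  qed (use two_neq_0 four in \<open>auto simp: field_simps\<close>)
  hence 2: "card ?A = card ?B" by (rule bij_betw_same_card)
  show ?thesis
  proof (cases "a = 0")
    case True
    have "?B = {0} \<times> Fq \<union> (Fq - {0}) \<times> {0}"
      using True Fq.zero_F by auto
    hence "card ?B = card ({0::'k} \<times> Fq) + card ((Fq - {0}) \<times> {0::'k})"
      by (simp only:, subst card_Un_disjoint) (auto simp: Fq.fin_F)
    hence "card ?B = q + (q - 1)"
      by (simp add: card_cartesian_product card_Fq Fq.zero_F)
    thus ?thesis using 1 2 True q_ge_2 by (simp add: bal_def of_nat_diff)
  next
    case False
    have "bij_betw fst ?B (Fq - {0})"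
      by (rule bij_betwI[where g = "\<lambda>u. (u, a / u)"])
        (use False a in \<open>auto simp: Fq.divide_F field_simps\<close>)
    hence "card ?B = card (Fq - {0})" by (rule bij_betw_same_card)
    also have "\<dots> = q - 1" by (simp add: card_Fq Fq.zero_F)
    finally show ?thesis using 1 2 False q_ge_2 by (simp add: bal_def of_nat_diff)
  qed
qed

lemma sum_eta_quadratic:
  assumes "c \<in> Fq" "l \<in> Fq" "l \<noteq> 0"
  shows "(\<Sum>x\<in>Fq. eta p m (c - l * x\<^sup>2)) = eta p m (- l) * bal c"
proof -
  have "(\<Sum>x\<in>Fq. eta p m (c - l * x\<^sup>2)) = (\<Sum>x\<in>Fq. eta p m (- l) * eta p m (x\<^sup>2 - c / l))"
  proof (intro sum.cong refl)
    fix x assume "x \<in> Fq"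
    moreover have "c - l * x\<^sup>2 = - l * (x\<^sup>2 - c / l)" using assms by (simp add: field_simps)
    ultimately show "eta p m (c - l * x\<^sup>2) = eta p m (- l) * eta p m (x\<^sup>2 - c / l)"
      using assms by (simp only:) (intro eta_mult Fq.uminus_F Fq.diff_F Fq.power_F Fq.divide_F)
  qed
  also have "\<dots> = eta p m (- l) * bal (c / l)"
    by (simp add: sum_eta_shifted_square Fq.divide_F assms flip: sum_distrib_left)
  finally show ?thesis using assms by (simp add: bal_def)
qed

text \<open>\<open>bal\<close> is q times the indicator of 0, minus 1, so the sum counts the square
  roots of c / l; eta(l)^2 = 1 then turns the quotient into the product c l.\<close>

lemma sum_bal_quadratic:
  assumes "c \<in> Fq" "l \<in> Fq" "l \<noteq> 0"
  shows "(\<Sum>x\<in>Fq. bal (c - l * x\<^sup>2)) = int q * eta p m (c * l)"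
proof -
  have "(\<Sum>x\<in>Fq. bal (c - l * x\<^sup>2)) = (\<Sum>x\<in>Fq. (if c - l * x\<^sup>2 = 0 then int q else 0) - 1)"
    by (intro sum.cong) (auto simp: bal_def)
  also have "\<dots> = int q * card {x\<in>Fq. c - l * x\<^sup>2 = 0} - int q"
    by (simp add: sum_subtractf card_Fq Fq.fin_F flip: sum.inter_filter)
  also have "{x\<in>Fq. c - l * x\<^sup>2 = 0} = {x\<in>Fq. x\<^sup>2 = c / l}"
    using assms by (auto simp: field_simps)
  also have "int (card \<dots>) = 1 + eta p m (c / l)"
    by (intro card_sqrt Fq.divide_F assms)
  also have "eta p m (c / l) = eta p m (c / l) * (eta p m l * eta p m l)"
    using assms by (simp add: eta_square)
  also have "\<dots> = eta p m (c * l)"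
    using assms by (simp add: Fq.divide_F Fq.mult_F flip: eta_mult)
  finally show ?thesis by (simp add: algebra_simps)
qed

definition num_sols :: "nat \<Rightarrow> (nat \<Rightarrow> 'k) \<Rightarrow> 'k \<Rightarrow> nat" where
  "num_sols n l c = card {v \<in> {..<n} \<rightarrow>\<^sub>E Fq. (\<Sum>i<n. l i * (v i)\<^sup>2) = c}"

lemma num_sols_0: "num_sols 0 l c = (if c = 0 then 1 else 0)"
  by (auto simp: num_sols_def)

lemma num_sols_Suc: "num_sols (Suc n) l c = (\<Sum>x\<in>Fq. num_sols n l (c - l n * x\<^sup>2))"
proof -
  let ?S = "\<lambda>n c. {v \<in> {..<n} \<rightarrow>\<^sub>E Fq. (\<Sum>i<n. l i * (v i)\<^sup>2) = c}"
  have "bij_betw (\<lambda>(x, v). v(n := x)) (SIGMA x:Fq. ?S n (c - l n * x\<^sup>2)) (?S (Suc n) c)"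
  proof (rule bij_betwI[where g = "\<lambda>v. (v n, v(n := undefined))"])
    show "(\<lambda>(x, v). v(n := x)) \<in> (SIGMA x:Fq. ?S n (c - l n * x\<^sup>2)) \<rightarrow> ?S (Suc n) c"
      by (auto simp: PiE_iff extensional_def less_Suc_eq)
    show "(\<lambda>v. (v n, v(n := undefined))) \<in> ?S (Suc n) c \<rightarrow> (SIGMA x:Fq. ?S n (c - l n * x\<^sup>2))"
      by (auto simp: PiE_iff extensional_def)
    fix z assume "z \<in> (SIGMA x:Fq. ?S n (c - l n * x\<^sup>2))"
    thus "(\<lambda>v. (v n, v(n := undefined))) ((\<lambda>(x, v). v(n := x)) z) = z"
      by (auto simp: PiE_iff extensional_def fun_eq_iff)
  qed auto
  hence "num_sols (Suc n) l c = card (SIGMA x:Fq. ?S n (c - l n * x\<^sup>2))"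
    unfolding num_sols_def by (simp add: bij_betw_same_card)
  also have "\<dots> = (\<Sum>x\<in>Fq. num_sols n l (c - l n * x\<^sup>2))"
    unfolding num_sols_def
    by (rule card_SigmaI) (simp_all add: Fq.fin_F finite_PiE)
  finally show ?thesis .
qed

text \<open>A variable with coefficient 0 is free and contributes a factor q.\<close>

lemma num_sols_zero_tail:
  assumes "\<And>i. s \<le> i \<Longrightarrow> l i = 0"
  shows "num_sols (s + j) l c = q ^ j * num_sols s l c"
  by (induction j) (simp_all add: num_sols_Suc assms card_Fq)

text \<open>The even formula is a hypothesis here because its own induction step passes through this
  odd case. It is multiplied by q to avoid the exponents 2k - 1 and k - 1 at k = 0.\<close>

lemma num_sols_odd_step:
  assumes l0: "\<And>i. i < n \<Longrightarrow> l i \<in> Fq - {0}"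
    and ev: "\<And>c. c \<in> Fq \<Longrightarrow> int q * num_sols (2 * k) l c =
      int q ^ (2 * k) + bal c * int q ^ k * eta p m ((- 1) ^ k * (\<Prod>i<2 * k. l i))"
    and k: "2 * k + 1 \<le> n" and c: "c \<in> Fq"
  shows "int (num_sols (2 * k + 1) l c) =
      int q ^ (2 * k) + int q ^ k * eta p m ((- 1) ^ k * c * (\<Prod>i<2 * k + 1. l i))"
proof -
  let ?E = "eta p m ((- 1) ^ k * (\<Prod>i<2 * k. l i))"
  have l: "l (2 * k) \<in> Fq" "l (2 * k) \<noteq> 0" using l0[of "2 * k"] k by auto
  have P: "(- 1) ^ k * (\<Prod>i<2 * k. l i) \<in> Fq"
    using l0 k
    by (intro Fq.mult_F Fq.power_F Fq.uminus_F Fq.one_F Fq.prod_F) auto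
  have "int q * num_sols (2 * k + 1) l c =
      (\<Sum>x\<in>Fq. int q * num_sols (2 * k) l (c - l (2 * k) * x\<^sup>2))"
    by (simp add: num_sols_Suc sum_distrib_left)
  also have "\<dots> = (\<Sum>x\<in>Fq. int q ^ (2 * k) + int q ^ k * ?E * bal (c - l (2 * k) * x\<^sup>2))"
    using l c by (intro sum.cong refl, subst ev)
      (auto intro!: Fq.diff_F Fq.mult_F Fq.power_F simp: mult_ac)
  also have "\<dots> = int q * (int q ^ (2 * k) + int q ^ k * (?E * eta p m (c * l (2 * k))))"
    using l c by (simp add: sum.distrib card_Fq sum_bal_quadratic distrib_left mult.left_commute
        flip: sum_distrib_left)
  also have "?E * eta p m (c * l (2 * k)) = eta p m ((- 1) ^ k * c * (\<Prod>i<2 * k + 1. l i))"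
    using P l c by (subst eta_mult[symmetric]) (auto simp: Fq.mult_F mult_ac)
  finally show ?thesis using p_ge_2 by simp
qed

lemma num_sols_even:
  assumes l0: "\<And>i. i < n \<Longrightarrow> l i \<in> Fq - {0}" and "2 * k \<le> n" and "c \<in> Fq"
  shows "int q * num_sols (2 * k) l c =
      int q ^ (2 * k) + bal c * int q ^ k * eta p m ((- 1) ^ k * (\<Prod>i<2 * k. l i))"
  using \<open>2 * k \<le> n\<close> \<open>c \<in> Fq\<close>
proof (induction k arbitrary: c)
  case 0
  thus ?case by (simp add: num_sols_0 bal_def eta_1)
next
  case (Suc k)
  have IH: "int q * num_sols (2 * k) l c =
      int q ^ (2 * k) + bal c * int q ^ k * eta p m ((- 1) ^ k * (\<Prod>i<2 * k. l i))"
    if "c \<in> Fq" for c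
    using Suc.IH[OF _ that] Suc.prems by simp
  let ?D = "eta p m ((- 1) ^ k * (\<Prod>i<2 * k + 1. l i))"
  have k: "2 * k + 1 < n" using Suc.prems by simp
  have l: "l (2 * k + 1) \<in> Fq" "l (2 * k + 1) \<noteq> 0" using l0[OF k] by auto
  have P: "(- 1) ^ k * (\<Prod>i<2 * k + 1. l i) \<in> Fq"
    using l0 k by (intro Fq.mult_F Fq.power_F Fq.uminus_F Fq.one_F Fq.prod_F) auto
  have "int (num_sols (2 * Suc k) l c) =
      (\<Sum>x\<in>Fq. int (num_sols (2 * k + 1) l (c - l (2 * k + 1) * x\<^sup>2)))"
    by (simp add: num_sols_Suc)
  also have "\<dots> = (\<Sum>x\<in>Fq. int q ^ (2 * k) + int q ^ k * ?D * eta p m (c - l (2 * k + 1) * x\<^sup>2))"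
  proof (intro sum.cong refl)
    fix x assume "x \<in> Fq"
    hence mem: "c - l (2 * k + 1) * x\<^sup>2 \<in> Fq"
      using l Suc.prems by (auto intro!: Fq.diff_F Fq.mult_F Fq.power_F)
    have "eta p m ((- 1) ^ k * (c - l (2 * k + 1) * x\<^sup>2) * (\<Prod>i<2 * k + 1. l i)) =
      ?D * eta p m (c - l (2 * k + 1) * x\<^sup>2)"
      using P mem by (subst eta_mult[symmetric]) (auto simp: mult_ac)
    thus "int (num_sols (2 * k + 1) l (c - l (2 * k + 1) * x\<^sup>2)) =
        int q ^ (2 * k) + int q ^ k * ?D * eta p m (c - l (2 * k + 1) * x\<^sup>2)"
      using num_sols_odd_step[OF l0 IH _ mem] k by (simp add: mult.assoc)
  qed
  also have "\<dots> = int q * int q ^ (2 * k) + int q ^ k * ((?D * eta p m (- l (2 * k + 1))) * bal c)"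
    using l Suc.prems by (simp add: sum.distrib card_Fq sum_eta_quadratic mult.assoc
        flip: sum_distrib_left)
  also have "?D * eta p m (- l (2 * k + 1)) = eta p m ((- 1) ^ Suc k * (\<Prod>i<2 * Suc k. l i))"
    using P l by (subst eta_mult[symmetric]) (auto simp: Fq.uminus_F mult_ac)
  finally show ?case by (simp add: algebra_simps)
qed

lemma num_sols_odd:
  assumes l0: "\<And>i. i < n \<Longrightarrow> l i \<in> Fq - {0}" and "2 * k + 1 \<le> n" and "c \<in> Fq"
  shows "int (num_sols (2 * k + 1) l c) =
      int q ^ (2 * k) + int q ^ k * eta p m ((- 1) ^ k * c * (\<Prod>i<2 * k + 1. l i))"
  by (rule num_sols_odd_step[OF l0 num_sols_even[OF l0]]) (use assms in auto)

end

section \<open>Diagonalisation of quadratic forms\<close>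

context finite_subfield
begin

sublocale self: finite_subfield_module F "(*)"
  by unfold_locales (simp_all add: module_def distrib_left distrib_right mult.assoc)

lemma indep_k_iff: "indep_k F e r \<longleftrightarrow> self.indep e r"
  by (simp add: indep_k_def self.indep_def)

lemma span_k_eq: "span_k F e r = self.lspan e r"
  by (simp add: span_k_def self.lspan_def)

lemma dim_k_eq:
  assumes "is_basis_k F W e n"
  shows "dim_k F W = n"
  unfolding dim_k_def
proof (rule the_equality)
  show "\<exists>e. is_basis_k F W e n" using assms by blast
next
  fix r assume "\<exists>e. is_basis_k F W e r"
  then obtain e' where "is_basis_k F W e' r" by blast
  hence "card F ^ r = card F ^ n"
    using assms by (metis indep_k_iff is_basis_k_def self.card_lspan span_k_eq)
  thus "r = n" using card_F_ge_2 by (simp add: power_inject_exp)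
qed

end

lemma sum_lessThan_add:
  fixes f :: "nat \<Rightarrow> 'a::comm_monoid_add"
  shows "(\<Sum>i<s + t. f i) = (\<Sum>i<s. f i) + (\<Sum>i<t. f (s + i))"
  by (induction t) (auto simp: add.assoc)

locale quadratic_form = odd_prime_char p ty m for p and ty :: "'k::field itself" and m +
  fixes m1 :: nat and Q :: "'k \<Rightarrow> 'k"
  assumes m1_ge_1: "m1 \<ge> 1"
    and card_K: "card (Fsub p (m * m1) :: 'k set) = p ^ (m * m1)"
    and quad: "is_quad_form p m m1 Q"
begin

abbreviation K :: "'k set" where "K \<equiv> Fsub p (m * m1)"

sublocale K: finite_subfield K
  using m_ge_1 m1_ge_1 by (intro finite_subfield_Fsub) (simp add: Suc_leI)

lemma Fq_subset_K: "Fq \<subseteq> K"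
  by (rule Fsub_mono)

lemma lin_closed_K: "Fq.self.lin_closed K"
  using Fq_subset_K by (auto simp: Fq.self.lin_closed_def K.zero_F K.add_F intro!: K.mult_F)

lemma Q_in: "x \<in> K \<Longrightarrow> Q x \<in> Fq"
  and Q_scale: "a \<in> Fq \<Longrightarrow> x \<in> K \<Longrightarrow> Q (a * x) = a\<^sup>2 * Q x"
  using quad by (auto simp: is_quad_form_def)

lemma bil_add_left: "x \<in> K \<Longrightarrow> z \<in> K \<Longrightarrow> y \<in> K \<Longrightarrow> bil Q (x + z) y = bil Q x y + bil Q z y"
  and bil_scale_left: "a \<in> Fq \<Longrightarrow> x \<in> K \<Longrightarrow> y \<in> K \<Longrightarrow> bil Q (a * x) y = a * bil Q x y"
  using quad Fq.zero_F unfolding is_quad_form_def by blast+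

lemma bil_sym: "bil Q x y = bil Q y x"
  by (simp add: bil_def add.commute)

lemma bil_in: "x \<in> K \<Longrightarrow> y \<in> K \<Longrightarrow> bil Q x y \<in> Fq"
  by (auto simp: bil_def intro!: Fq.divide_F Fq.diff_F Q_in K.add_F two_in_Fq)

lemma Q_add: "Q (x + y) = Q x + Q y + 2 * bil Q x y"
  using two_neq_0 by (simp add: bil_def field_simps)

lemma bil_self: "x \<in> K \<Longrightarrow> bil Q x x = Q x"
proof -
  assume "x \<in> K"
  hence "Q (x + x) = 4 * Q x" using Q_scale[of 2 x] two_in_Fq by (simp flip: mult_2)
  hence "bil Q x x = (2 * Q x) / 2" by (simp add: bil_def)
  thus ?thesis using two_neq_0 by simp
qed

lemma Q_0: "Q 0 = 0"
  using Q_scale[OF Fq.zero_F K.zero_F] by simp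

lemma bil_0_left: "y \<in> K \<Longrightarrow> bil Q 0 y = 0"
  by (simp add: bil_def Q_0)

lemma bil_sum_left:
  fixes n :: nat
  assumes "\<And>i. i < n \<Longrightarrow> e i \<in> K" "\<And>i. i < n \<Longrightarrow> c i \<in> Fq" "y \<in> K"
  shows "bil Q (\<Sum>i<n. c i * e i) y = (\<Sum>i<n. c i * bil Q (e i) y)"
  using assms
proof (induction n)
  case (Suc n)
  have "(\<Sum>i<n. c i * e i) \<in> K" "c n * e n \<in> K"
    using Suc.prems Fq_subset_K by (auto intro!: K.sum_F K.mult_F)
  thus ?case using Suc by (simp add: bil_add_left bil_scale_left)
qed (simp add: bil_0_left)

text \<open>Gram-Schmidt: a vector \<open>w\<close> with \<open>Q w \<noteq> 0\<close> splits off
  its orthogonal complement in \<open>W\<close>. If Q vanishes on \<open>W\<close>, so does its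
  polar form, and any basis serves. The number \<open>s\<close> of leading vectors with nonzero Q
  will turn out to be the rank.\<close>

lemma orthogonal_basis:
  fixes n :: nat
  assumes "Fq.self.lin_closed W" "W \<subseteq> K" "card W = q ^ n"
  shows "\<exists>e s. s \<le> n \<and> (\<forall>i<n. e i \<in> W) \<and> Fq.self.indep e n \<and>
    (\<forall>i<n. \<forall>j<n. i \<noteq> j \<longrightarrow> bil Q (e i) (e j) = 0) \<and> (\<forall>i<n. Q (e i) \<noteq> 0 \<longleftrightarrow> i < s)"
  using assms
proof (induction n arbitrary: W)
  case 0
  show ?case by (intro exI[of _ "\<lambda>_. 0"] exI[of _ "0::nat"]) (auto simp: Fq.self.indep_0)
next
  case (Suc n)
  have finW: "finite W" using Suc.prems K.fin_F finite_subset by blast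
  show ?case
  proof (cases "\<forall>w\<in>W. Q w = 0")
    case True
    have "\<exists>e. (\<forall>i<0. e i = (0::'k)) \<and> Fq.self.indep e (Suc n) \<and> (\<forall>i<Suc n. e i \<in> W)"
      using Suc.prems finW
      by (intro Fq.self.indep_extend) (auto simp: Fq.self.indep_0 card_Fq)
    then obtain e where e: "Fq.self.indep e (Suc n)" "\<forall>i<Suc n. e i \<in> W" by blast
    have "bil Q x y = 0" if "x \<in> W" "y \<in> W" for x y
      using True that Fq.self.lin_closed_add[OF Suc.prems(1) that] by (simp add: bil_def)
    thus ?thesis using e True by (intro exI[of _ e] exI[of _ "0::nat"]) auto
  next
    case False
    then obtain w where w: "w \<in> W" "Q w \<noteq> 0" by blast
    have wK: "w \<in> K" using w Suc.prems by blast
    define W' where "W' = {x\<in>W. bil Q w x = 0}"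
    have W'W: "W' \<subseteq> W" by (auto simp: W'_def)
    have bil_diff: "bil Q w (x - y) = bil Q w x - bil Q w y" if "x \<in> W" "y \<in> W" for x y
    proof -
      have "x \<in> K" "y \<in> K" using that Suc.prems by auto
      hence "bil Q w ((x - y) + y) = bil Q w (x - y) + bil Q w y"
        using wK by (simp only: bil_sym[of w] bil_add_left K.diff_F)
      thus ?thesis by simp
    qed
    \<comment> \<open>Already the multiples of \<open>w\<close> reach every value, as
      \<open>bil Q w w = Q w\<close>; therefore the complement has index q.\<close>
    have "bil Q w ` W = Fq"
    proof
      show "bil Q w ` W \<subseteq> Fq" using Suc.prems(2) wK bil_in by blast
      show "Fq \<subseteq> bil Q w ` W"
      proof
        fix c assume c: "c \<in> Fq"
        hence "c / Q w \<in> Fq" using Q_in[OF wK] by (rule Fq.divide_F)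
        hence "bil Q w (c / Q w * w) = c / Q w * Q w" "c / Q w * w \<in> W"
          using w wK Suc.prems(1) bil_scale_left[of "c / Q w" w w] bil_self[OF wK]
          by (simp_all only: bil_sym[of w "_ * _"] Fq.self.lin_closed_scale)
        hence "bil Q w (c / Q w * w) = c" "c / Q w * w \<in> W" using w by simp_all
        thus "c \<in> bil Q w ` W" by (metis image_eqI)
      qed
    qed
    hence "card W = q * card W'"
      using card_additive_image[OF finW Fq.self.lin_closed_diff[OF Suc.prems(1)] bil_diff]
      by (simp add: W'_def card_Fq)
    hence cW': "card W' = q ^ n" using Suc.prems(3) p_ge_2 by simp
    have lcW': "Fq.self.lin_closed W'"
      unfolding Fq.self.lin_closed_def
    proof (intro conjI ballI)
      show "0 \<in> W'"
        using Fq.self.lin_closed_zero[OF Suc.prems(1)] wK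
        by (simp add: W'_def bil_sym[of w] bil_0_left)
    next
      fix x y assume "x \<in> W'" "y \<in> W'"
      thus "x + y \<in> W'"
        using Suc.prems(2) wK Fq.self.lin_closed_add[OF Suc.prems(1)]
        by (auto simp: W'_def bil_sym[of w] bil_add_left subset_iff)
    next
      fix a x assume "a \<in> Fq" "x \<in> W'"
      thus "a * x \<in> W'"
        using Suc.prems(2) wK Fq.self.lin_closed_scale[OF Suc.prems(1)]
        by (auto simp: W'_def bil_sym[of w] bil_scale_left subset_iff)
    qed
    have "W' \<subseteq> K" using W'W Suc.prems(2) by blast
    then obtain e s where e: "s \<le> n" "\<forall>i<n. e i \<in> W'" "Fq.self.indep e n"
      "\<forall>i<n. \<forall>j<n. i \<noteq> j \<longrightarrow> bil Q (e i) (e j) = 0" "\<forall>i<n. Q (e i) \<noteq> 0 \<longleftrightarrow> i < s"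
      using Suc.IH[OF lcW' _ cW'] by blast
    have "w \<notin> W'" using w wK by (simp add: W'_def bil_self)
    moreover have "Fq.self.lspan e n \<subseteq> W'" using e by (intro Fq.self.lspan_subset[OF lcW']) auto
    ultimately have ind: "Fq.self.indep (case_nat w e) (Suc n)"
      using e by (intro Fq.self.indep_Suc_shift) auto
    have orth: "bil Q w (e i) = 0" "bil Q (e i) w = 0" if "i < n" for i
      using e(2) that bil_sym[of w "e i"] by (auto simp: W'_def)
    show ?thesis
    proof (intro exI[of _ "case_nat w e"] exI[of _ "Suc s"] conjI allI impI)
      fix i assume "i < Suc n"
      thus "case_nat w e i \<in> W" "(Q (case_nat w e i) \<noteq> 0) = (i < Suc s)"
        using e w W'W by (auto split: nat.splits)
      fix j assume "j < Suc n" "i \<noteq> j"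
      thus "bil Q (case_nat w e i) (case_nat w e j) = 0"
        using \<open>i < Suc n\<close> e(4) orth by (auto split: nat.splits)
    qed (use e ind in auto)
  qed
qed

lemma Q_orthogonal_sum:
  fixes n :: nat
  assumes "\<And>i. i < n \<Longrightarrow> e i \<in> K" "\<And>i. i < n \<Longrightarrow> c i \<in> Fq"
    and "\<And>i j. i < n \<Longrightarrow> j < n \<Longrightarrow> i \<noteq> j \<Longrightarrow> bil Q (e i) (e j) = 0"
  shows "Q (\<Sum>i<n. c i * e i) = (\<Sum>i<n. Q (e i) * (c i)\<^sup>2)"
  using assms
proof (induction n)
  case (Suc n)
  have "(\<Sum>i<n. c i * e i) \<in> K"
    using Suc.prems(1,2) Fq_subset_K by (auto intro!: K.sum_F K.mult_F)
  moreover have "bil Q (\<Sum>i<n. c i * e i) (e n) = 0"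
    using Suc.prems by (subst bil_sum_left) auto
  ultimately have "bil Q (\<Sum>i<n. c i * e i) (c n * e n) = 0"
    using Suc.prems(1,2) by (simp add: bil_sym[of _ "c n * e n"] bil_scale_left bil_sym[of "e n"])
  thus ?case using Suc by (simp add: Q_add Q_scale mult.commute)
qed (simp add: Q_0)

text \<open>In an orthogonal basis the radical is spanned by the vectors on which Q vanishes, here
  the last m1 - s, so the rank is s. Both claims rest on the same basis and are proved
  together.\<close>

lemma is_diag_exists: "\<exists>l. is_diag p m m1 Q l" and qf_rank_le: "qf_rank p m m1 Q \<le> m1"
proof -
  have "card K = q ^ m1" using card_K by (simp add: power_mult)
  then obtain e s where s: "s \<le> m1" and e: "\<forall>i<m1. e i \<in> K" "Fq.self.indep e m1"
    and orth: "\<forall>i<m1. \<forall>j<m1. i \<noteq> j \<longrightarrow> bil Q (e i) (e j) = 0"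
    and nz: "\<forall>i<m1. Q (e i) \<noteq> 0 \<longleftrightarrow> i < s"
    using orthogonal_basis[OF lin_closed_K subset_refl] by blast
  have span: "Fq.self.lspan e m1 = K"
    using e \<open>card K = q ^ m1\<close> by (intro Fq.self.lspan_eq lin_closed_K) (auto simp: K.fin_F card_Fq)
  define t where "t = m1 - s"
  have st: "m1 = s + t" using s by (simp add: t_def)
  define R where "R = {x\<in>K. \<forall>y\<in>K. bil Q x y = 0}"
  have coord: "bil Q (e j) (\<Sum>i<m1. c i * e i) = c j * Q (e j)"
    if "\<forall>i<m1. c i \<in> Fq" "j < m1" for c j
  proof -
    have "bil Q (e j) (\<Sum>i<m1. c i * e i) = (\<Sum>i<m1. c i * bil Q (e i) (e j))"
      using that e by (subst bil_sym) (auto intro!: bil_sum_left)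
    also have "\<dots> = (\<Sum>i<m1. if i = j then c j * Q (e j) else 0)"
      using orth that e(1) by (intro sum.cong) (auto simp: bil_self)
    finally show ?thesis using that by (simp add: sum_lessThan_if)
  qed
  have basis: "is_basis_k Fq R (\<lambda>i. e (s + i)) t"
    unfolding is_basis_k_def Fq.indep_k_iff Fq.span_k_eq
  proof (intro conjI allI impI)
    show eR: "e (s + i) \<in> R" if "i < t" for i
      unfolding R_def
    proof (intro CollectI conjI ballI)
      show "e (s + i) \<in> K" using e that st by simp
      fix y assume "y \<in> K"
      then obtain c where "y = (\<Sum>i<m1. c i * e i)" "\<forall>i<m1. c i \<in> Fq"
        unfolding span[symmetric] Fq.self.lspan_def by blast
      moreover have "Q (e (s + i)) = 0" using nz[rule_format, of "s + i"] that st by simp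
      ultimately show "bil Q (e (s + i)) y = 0" using coord[of c "s + i"] that st by simp
    qed
    show "Fq.self.indep (\<lambda>i. e (s + i)) t"
      unfolding Fq.self.indep_def
    proof (intro allI impI)
      fix c i assume c: "\<forall>i<t. c i \<in> Fq" "(\<Sum>i<t. c i * e (s + i)) = 0" "i < t"
      \<comment> \<open>A relation among the last t vectors, padded with zeros, is a relation among
        all m1.\<close>
      define d where "d i = (if i < s then 0 else c (i - s))" for i
      have "(\<Sum>i<m1. d i * e i) = 0"
        unfolding st sum_lessThan_add using c by (simp add: d_def)
      moreover have "d i \<in> Fq" if "i < m1" for i
        using c(1) st that by (cases "i < s") (auto simp: d_def Fq.zero_F)
      moreover have "s + i < m1" using c(3) st by simp
      ultimately have "d (s + i) = 0"
        using Fq.self.indepD[OF e(2), of d "s + i"] by blast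
      thus "c i = 0" by (simp add: d_def)
    qed
    show "Fq.self.lspan (\<lambda>i. e (s + i)) t = R"
    proof
      show "R \<subseteq> Fq.self.lspan (\<lambda>i. e (s + i)) t"
      proof
        fix x assume x: "x \<in> R"
        then obtain c where c: "x = (\<Sum>i<m1. c i * e i)" "\<forall>i<m1. c i \<in> Fq"
          unfolding R_def span[symmetric] Fq.self.lspan_def by blast
        have "c i = 0" if "i < s" for i
        proof -
          have "bil Q (e i) x = 0" using x e st that by (auto simp: R_def bil_sym[of _ x])
          moreover have "Q (e i) \<noteq> 0" using nz[rule_format, of i] that st by simp
          ultimately show ?thesis using coord[OF c(2), of i] c(1) that st by simp
        qed
        hence "x = (\<Sum>i<t. c (s + i) * e (s + i))"
          unfolding c(1) st sum_lessThan_add by simp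
        thus "x \<in> Fq.self.lspan (\<lambda>i. e (s + i)) t"
          using c(2) st Fq.self.lspanI[of t "\<lambda>i. c (s + i)"] by simp
      qed
      have "Fq.self.lin_closed R"
        unfolding Fq.self.lin_closed_def R_def
        using Fq_subset_K
        by (auto simp: bil_add_left bil_scale_left bil_0_left K.zero_F K.add_F intro!: K.mult_F)
      thus "Fq.self.lspan (\<lambda>i. e (s + i)) t \<subseteq> R"
        using eR by (rule Fq.self.lspan_subset)
    qed
  qed
  have rank: "qf_rank p m m1 Q = s"
    unfolding qf_rank_def using Fq.dim_k_eq[OF basis] st by (simp add: R_def)
  show "qf_rank p m m1 Q \<le> m1" using rank s by simp
  have "Q (\<Sum>i<m1. c i * e i) = (\<Sum>i<s. Q (e i) * (c i)\<^sup>2)" if "\<forall>i<m1. c i \<in> Fq" for c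
  proof -
    have "Q (\<Sum>i<m1. c i * e i) = (\<Sum>i<m1. Q (e i) * (c i)\<^sup>2)"
      using that e orth by (intro Q_orthogonal_sum) auto
    also have "\<dots> = (\<Sum>i<s. Q (e i) * (c i)\<^sup>2)"
    proof -
      have "Q (e (s + i)) = 0" if "i < t" for i
        using nz[rule_format, of "s + i"] that st by simp
      thus ?thesis unfolding st sum_lessThan_add by simp
    qed
    finally show ?thesis .
  qed
  moreover have "\<forall>i<s. Q (e i) \<in> Fq - {0}" using nz e s Q_in by auto
  moreover have "is_basis_k Fq K e m1"
    using e span by (simp add: is_basis_k_def Fq.indep_k_iff Fq.span_k_eq)
  ultimately have "is_diag p m m1 Q (\<lambda>i. Q (e i))"
    unfolding is_diag_def rank by blast
  thus "\<exists>l. is_diag p m m1 Q l" by blast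
qed

text \<open>The choice made in \<open>eps_Q\<close>, padded with zeros so that the form can be
  summed over all m1 coordinates.\<close>

definition diag :: "nat \<Rightarrow> 'k" where
  "diag i = (if i < qf_rank p m m1 Q then (SOME l. is_diag p m m1 Q l) i else 0)"

lemma eps_Q_eq: "eps_Q p m m1 Q = eta p m (\<Prod>i<qf_rank p m m1 Q. diag i)"
  by (simp add: eps_Q_def diag_def)

lemma is_diag_diag: "is_diag p m m1 Q diag"
proof -
  define l where "l = (SOME l. is_diag p m m1 Q l)"
  have "is_diag p m m1 Q l" unfolding l_def by (rule someI_ex[OF is_diag_exists])
  moreover have diag: "diag i = l i" if "i < qf_rank p m m1 Q" for i
    using that by (simp add: diag_def l_def)
  moreover have "(\<Sum>i<qf_rank p m m1 Q. diag i * (c i)\<^sup>2) = (\<Sum>i<qf_rank p m m1 Q. l i * (c i)\<^sup>2)" for c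
    using diag by (intro sum.cong) auto
  ultimately show ?thesis by (simp add: is_diag_def)
qed

lemma diag_nonzero: "i < qf_rank p m m1 Q \<Longrightarrow> diag i \<in> Fq - {0}"
  using is_diag_diag unfolding is_diag_def by blast

definition zeros :: nat where "zeros = card {x\<in>K. Q x = 0}"

lemma zeros_eq:
  "zeros = q ^ (m1 - qf_rank p m m1 Q) * num_sols (qf_rank p m m1 Q) diag 0"
proof -
  define s where "s = qf_rank p m m1 Q"
  obtain e where e: "is_basis_k Fq K e m1"
    and Q: "\<And>c. (\<forall>i<m1. c i \<in> Fq) \<Longrightarrow> Q (\<Sum>i<m1. c i * e i) = (\<Sum>i<s. diag i * (c i)\<^sup>2)"
    using is_diag_diag unfolding is_diag_def s_def by blast
  have ind: "Fq.self.indep e m1" and span: "Fq.self.lspan e m1 = K"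
    using e by (auto simp: is_basis_k_def Fq.indep_k_iff Fq.span_k_eq)
  have Q': "Q (\<Sum>i<m1. c i * e i) = (\<Sum>i<m1. diag i * (c i)\<^sup>2)" if "\<forall>i<m1. c i \<in> Fq" for c
  proof -
    have "(\<Sum>i<s. diag i * (c i)\<^sup>2) = (\<Sum>i<m1. diag i * (c i)\<^sup>2)"
      using qf_rank_le by (intro sum.mono_neutral_left) (auto simp: s_def diag_def)
    thus ?thesis using Q[OF that] by simp
  qed
  have "bij_betw (\<lambda>c. \<Sum>i<m1. c i * e i) {c \<in> {..<m1} \<rightarrow>\<^sub>E Fq. (\<Sum>i<m1. diag i * (c i)\<^sup>2) = 0}
      {x\<in>K. Q x = 0}"
    unfolding bij_betw_def
  proof
    show "inj_on (\<lambda>c. \<Sum>i<m1. c i * e i) {c \<in> {..<m1} \<rightarrow>\<^sub>E Fq. (\<Sum>i<m1. diag i * (c i)\<^sup>2) = 0}"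
      by (rule inj_on_subset[OF Fq.self.indep_inj_on[OF ind]]) auto
    have "{x\<in>K. Q x = 0} = (\<lambda>c. \<Sum>i<m1. c i * e i) ` {c \<in> {..<m1} \<rightarrow>\<^sub>E Fq. Q (\<Sum>i<m1. c i * e i) = 0}"
      unfolding span[symmetric] Fq.self.lspan_PiE by blast
    also have "{c \<in> {..<m1} \<rightarrow>\<^sub>E Fq. Q (\<Sum>i<m1. c i * e i) = 0} =
        {c \<in> {..<m1} \<rightarrow>\<^sub>E Fq. (\<Sum>i<m1. diag i * (c i)\<^sup>2) = 0}"
      using Q' by (auto simp: PiE_iff)
    finally show "(\<lambda>c. \<Sum>i<m1. c i * e i) ` {c \<in> {..<m1} \<rightarrow>\<^sub>E Fq. (\<Sum>i<m1. diag i * (c i)\<^sup>2) = 0} =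
        {x\<in>K. Q x = 0}" by simp
  qed
  hence "zeros = num_sols m1 diag 0"
    unfolding zeros_def num_sols_def by (simp add: bij_betw_same_card)
  also have "\<dots> = num_sols (s + (m1 - s)) diag 0"
    using qf_rank_le by (simp add: s_def)
  also have "\<dots> = q ^ (m1 - s) * num_sols s diag 0"
    by (rule num_sols_zero_tail) (simp add: s_def diag_def)
  finally show ?thesis by (simp add: s_def)
qed

text \<open>At c = 0 the character term of \<open>num_sols_odd\<close> is eta(0) = 0, so Q has
  exactly the average number of zeros.\<close>

lemma zeros_odd_rank:
  assumes "odd (qf_rank p m m1 Q)"
  shows "q * zeros = q ^ m1"
proof -
  obtain k where k: "qf_rank p m m1 Q = 2 * k + 1" using assms by (elim oddE)
  have "int (num_sols (2 * k + 1) diag 0) = int q ^ (2 * k)"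
    using num_sols_odd[of "2 * k + 1" diag k 0] diag_nonzero k
    by (simp add: Fq.zero_F eta_def)
  hence "int (num_sols (2 * k + 1) diag 0) = int (q ^ (2 * k))" by simp
  hence "num_sols (2 * k + 1) diag 0 = q ^ (2 * k)" by (simp only: of_nat_eq_iff)
  hence "q * zeros = q ^ (m1 - (2 * k + 1)) * q ^ (2 * k + 1)"
    unfolding zeros_eq k by simp
  also have "\<dots> = q ^ m1" using qf_rank_le k by (simp only: le_add_diff_inverse2 flip: power_add)
  finally show ?thesis .
qed

text \<open>The power of -1 in \<open>eps_sign\<close> is eta(-1)^k, because eta(-1) has exponent (p
  - 1)/2 * m.\<close>

lemma eps_sign_even_rank:
  assumes "qf_rank p m m1 Q = 2 * k"
  shows "eps_sign p m m1 Q = eta p m ((- 1) ^ k * (\<Prod>i<2 * k. diag i))"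
proof -
  obtain j where j: "p = 2 * j + 1" using odd_p by (elim oddE)
  have "(p - 1) * m * (2 * k) div 4 = (p - 1) div 2 * m * k"
    by (simp add: j)
  moreover have "(\<Prod>i<2 * k. diag i) \<in> Fq"
    using diag_nonzero assms by (intro Fq.prod_F) auto
  ultimately show ?thesis
    using assms
    by (simp add: eps_sign_def eps_Q_eq eta_mult eta_power eta_minus_1 Fq.power_F Fq.uminus_F
        Fq.one_F power_mult)
qed

text \<open>The factor q^k on the left keeps the exponent m1 - k out of the identity; it is divided
  out over the reals in \<open>bias_even_rank\<close>.\<close>

lemma zeros_even_rank:
  assumes "qf_rank p m m1 Q = 2 * k"
  shows "(int q * int zeros - int q ^ m1) * int q ^ k = eps_sign p m m1 Q * (int q - 1) * int q ^ m1"
proof -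
  have le: "2 * k \<le> m1" using qf_rank_le assms by simp
  let ?E = "eps_sign p m m1 Q"
  have "int q * int (num_sols (2 * k) diag 0) = int q ^ (2 * k) + (int q - 1) * int q ^ k * ?E"
    using num_sols_even[of "2 * k" diag k 0] diag_nonzero assms
    by (simp add: eps_sign_even_rank[OF assms] Fq.zero_F bal_def)
  hence "int q * int zeros = int q ^ (m1 - 2 * k) * (int q ^ (2 * k) + (int q - 1) * int q ^ k * ?E)"
    unfolding zeros_eq assms by (simp add: mult.left_commute)
  also have "\<dots> = int q ^ m1 + int q ^ (m1 - 2 * k) * (int q - 1) * int q ^ k * ?E"
    using le by (simp only: distrib_left mult.assoc le_add_diff_inverse2 flip: power_add)
  finally have "int q * int zeros - int q ^ m1 = int q ^ (m1 - 2 * k) * (int q - 1) * int q ^ k * ?E"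
    by linarith
  hence "(int q * int zeros - int q ^ m1) * int q ^ k =
      ?E * (int q - 1) * (int q ^ (m1 - 2 * k) * int q ^ k * int q ^ k)"
    by (simp only: mult_ac)
  also have "int q ^ (m1 - 2 * k) * int q ^ k * int q ^ k = int q ^ m1"
    using le by (simp only: add.assoc mult_2[symmetric] le_add_diff_inverse2 flip: power_add)
  finally show ?thesis .
qed

end

section \<open>Counting the zero coordinates of a subcode\<close>

locale descended_code = quadratic_form p ty m m1 Q
  for p and ty :: "'k::field itself" and m m1 and Q :: "'k \<Rightarrow> 'k" +
  fixes m2 N :: nat and \<theta> :: 'k
  assumes m2_ge_1: "m2 \<ge> 1"
    and card_L: "card (Fsub p (m * m2) :: 'k set) = p ^ (m * m2)"
    and Q_nonzero: "\<exists>x\<in>Fsub p (m * m1). Q x \<noteq> 0"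
    and N_pos: "N > 0" and N_dvd: "N dvd p - 1"
    and coprime_N: "coprime N ((p ^ m - 1) div (p - 1))"
    and \<theta>_in: "\<theta> \<in> Fsub p m" and \<theta>_power: "\<theta> ^ ((p ^ m - 1) div N) = 1"
    and \<theta>_primitive: "\<forall>k. 0 < k \<and> k < (p ^ m - 1) div N \<longrightarrow> \<theta> ^ k \<noteq> 1"
begin

definition Fp :: "'k set" where "Fp = Fsub p 1"
definition tr :: "'k \<Rightarrow> 'k" where "tr = trace p 1 m"
abbreviation L :: "'k set" where "L \<equiv> Fsub p (m * m2)"
abbreviation Tr :: "'k \<Rightarrow> 'k" where "Tr \<equiv> trace p m m2"
abbreviation n where "n \<equiv> (q - 1) div N"

sublocale Fp: finite_subfield Fp
  unfolding Fp_def by (rule finite_subfield_Fsub) simp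

sublocale L: finite_subfield L
  using m_ge_1 m2_ge_1 by (intro finite_subfield_Fsub) (simp add: Suc_leI)

lemma card_Fp: "card Fp = p"
  using card_Fsub_subfield[of 1 m] m_ge_1 card_Fq by (simp add: Fp_def)

lemma Fp_subset: "Fp \<subseteq> Fsub p e"
  using Fsub_mono[of 1 e] by (simp add: Fp_def)

lemma Fq_subset_L: "Fq \<subseteq> L"
  by (rule Fsub_mono)

lemma lin_closed_Fsub: "e \<ge> 1 \<Longrightarrow> Fp.self.lin_closed (Fsub p e)"
proof -
  assume "e \<ge> 1"
  then interpret E: finite_subfield "Fsub p e :: 'k set" by (rule finite_subfield_Fsub)
  show ?thesis
    using Fp_subset[of e] by (auto simp: Fp.self.lin_closed_def E.zero_F E.add_F intro!: E.mult_F)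
qed

lemma tr_in: "x \<in> Fq \<Longrightarrow> tr x \<in> Fp"
  using trace_in_Fsub[of x 1 m] by (simp add: tr_def Fp_def)

lemma tr_0: "tr 0 = 0"
  and tr_add: "tr (x + y) = tr x + tr y"
  and tr_diff: "tr (x - y) = tr x - tr y"
  by (simp_all add: tr_def trace_0 trace_add trace_diff)

lemma tr_scale: "c \<in> Fp \<Longrightarrow> tr (c * x) = c * tr x"
  unfolding tr_def Fp_def by (rule trace_scale)

lemma Tr_in: "x \<in> L \<Longrightarrow> Tr x \<in> Fq"
  by (rule trace_in_Fsub)

lemma tr_nonzero: "\<exists>z\<in>Fq. tr z \<noteq> 0"
  using trace_nonzero[of 1 m] m_ge_1 card_Fq by (simp add: tr_def)

lemma card_tr_fibre:
  assumes "u \<in> Fq" "u \<noteq> 0" "c \<in> Fp"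
  shows "p * card {z\<in>Fq. tr (z * u) = c} = q"
proof -
  obtain w where w: "w \<in> Fq" "tr w \<noteq> 0" using tr_nonzero by blast
  have "card Fp * card {z\<in>Fq. tr (z * u) = c} = card Fq"
  proof (rule Fp.self.card_functional_fibre[where w = "w / u"])
    show "Fp.self.lin_closed Fq" by (rule lin_closed_Fsub[OF m_ge_1])
    show "tr (a * x * u) = a * tr (x * u)" if "a \<in> Fp" for a x
      using tr_scale[OF that, of "x * u"] by (simp add: mult.assoc)
    show "tr ((x - y) * u) = tr (x * u) - tr (y * u)" for x y
      by (simp add: left_diff_distrib tr_diff)
    show "tr (x * u) \<in> Fp" if "x \<in> Fq" for x
      using that assms by (intro tr_in Fq.mult_F)
    show "w / u \<in> Fq" "tr (w / u * u) \<noteq> 0"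
      using assms w by (auto intro: Fq.divide_F)
  qed (use assms in \<open>simp_all add: Fq.fin_F\<close>)
  thus ?thesis by (simp add: card_Fp card_Fq)
qed

lemma card_Tr_fibre:
  assumes "z \<in> Fq" "z \<noteq> 0" "b \<in> L" "b \<noteq> 0" "c \<in> Fp"
  shows "p * card {y\<in>L. tr (z * Tr (b * y)) = c} = p ^ (m * m2)"
proof -
  have mm2: "m * m2 \<ge> 1" using m_ge_1 m2_ge_1 by (simp add: Suc_leI)
  obtain w where w: "w \<in> Fq" "tr w \<noteq> 0" using tr_nonzero by blast
  obtain y where y: "y \<in> L" "Tr y \<noteq> 0"
    using trace_nonzero[OF m_ge_1 m2_ge_1 card_L] by blast
  \<comment> \<open>As \<open>Tr\<close> is linear over \<open>Fq\<close>, this \<open>s\<close>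
    makes z Tr(b (s y / b)) = z s Tr(y) equal to w, whose trace is nonzero.\<close>
  define s where "s = w / (z * Tr y)"
  have s: "s \<in> Fq" using w y assms Tr_in by (auto simp: s_def intro!: Fq.divide_F Fq.mult_F)
  have "card Fp * card {y\<in>L. tr (z * Tr (b * y)) = c} = card L"
  proof (rule Fp.self.card_functional_fibre[where w = "s * y / b"])
    show "Fp.self.lin_closed L" by (rule lin_closed_Fsub[OF mm2])
    show "s * y / b \<in> L"
      using s y assms Fq_subset_L by (auto intro!: L.divide_F L.mult_F)
    have "z * Tr (b * (s * y / b)) = w"
      using assms(2,4) y by (simp add: trace_scale[OF s]) (simp add: s_def)
    thus "tr (z * Tr (b * (s * y / b))) \<noteq> 0" using w by simp
    fix a x assume a: "a \<in> Fp" "x \<in> L"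
    hence "Tr (b * (a * x)) = a * Tr (b * x)"
      using trace_scale[of a m m2 "b * x"] Fp_subset by (auto simp: mult.left_commute)
    thus "tr (z * Tr (b * (a * x))) = a * tr (z * Tr (b * x))"
      using tr_scale[OF a(1), of "z * Tr (b * x)"] by (simp add: mult.left_commute)
  qed (use assms in \<open>auto simp: L.fin_F trace_diff tr_diff right_diff_distrib
      intro!: tr_in Fq.mult_F Tr_in L.mult_F\<close>)
  thus ?thesis by (simp add: card_Fp card_L)
qed

subsection \<open>Powers of \<open>\<theta>\<close>\<close>

lemma p_minus_1_dvd: "p - 1 dvd q - 1"
proof -
  have "int p - 1 dvd int p ^ m - 1 ^ m"
    using power_diff_sumr2[of "int p" m 1] by simp
  hence "int (p - 1) dvd int (q - 1)"
    using p_ge_2 q_ge_2 by (simp add: of_nat_diff)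
  thus ?thesis by (simp only: of_nat_dvd_iff)
qed

lemma N_n: "N * n = q - 1"
  using N_dvd p_minus_1_dvd by (intro dvd_mult_div_cancel) (rule dvd_trans)

lemma n_pos: "n > 0"
  using N_n q_ge_2 by (cases "n = 0") auto

text \<open>With u = (p - 1)/N and l = (q - 1)/(p - 1) one has p - 1 = N u and n = u l, so the gcd
  is u gcd(N, l). Here the coprimality assumption enters.\<close>

lemma gcd_p_minus_1_n: "gcd (p - 1) n = (p - 1) div N"
proof -
  define u where "u = (p - 1) div N"
  define l where "l = (q - 1) div (p - 1)"
  have u: "p - 1 = N * u" using N_dvd by (simp add: u_def)
  have "N * n = N * (u * l)"
    unfolding N_n using p_minus_1_dvd u by (simp add: l_def flip: mult.assoc)
  hence n: "n = u * l" using N_pos by simp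
  have "gcd (p - 1) n = u * gcd N l"
    unfolding n unfolding u by (metis gcd_mult_distrib_nat mult.commute)
  thus ?thesis using coprime_N by (simp add: u_def l_def)
qed

lemma \<theta>_nonzero: "\<theta> \<noteq> 0"
  using \<theta>_power n_pos by (metis zero_neq_one zero_power)

lemma \<theta>_power_inj:
  assumes "i < n" "j < n" "\<theta> ^ i = \<theta> ^ j"
  shows "i = j"
proof -
  have *: False if "a < b" "b < n" "\<theta> ^ a = \<theta> ^ b" for a b
  proof -
    have "\<theta> ^ b = \<theta> ^ a * \<theta> ^ (b - a)" using that(1) by (metis less_imp_le le_add_diff_inverse power_add)
    hence "\<theta> ^ (b - a) = 1" using that \<theta>_nonzero by simp
    thus False using \<theta>_primitive that by (metis less_imp_diff_less zero_less_diff)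
  qed
  thus ?thesis using assms by (metis linorder_neqE_nat)
qed

text \<open>z = c \<theta>^i gives c^n = z^n, and also c^(p-1) = 1. By Bezout these determine c^u
  for u = gcd(p - 1, n) = (p - 1)/N, so at most u scalars c occur, and each of them fixes i.\<close>

lemma card_scaled_power_fibre_le:
  assumes z: "z \<noteq> 0"
  shows "card {(c, i). c \<in> Fp - {0} \<and> i < n \<and> c * \<theta> ^ i = z} \<le> (p - 1) div N"
proof -
  let ?A = "{(c, i). c \<in> Fp - {0} \<and> i < n \<and> c * \<theta> ^ i = z}" and ?u = "(p - 1) div N"
  have u: "?u > 0" using N_dvd N_pos p_ge_2 by (simp add: dvd_imp_le div_greater_zero_iff)
  have "p - 1 \<noteq> 0" using p_ge_2 by simp
  then obtain x y where xy: "(p - 1) * x = n * y + ?u"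
    using bezout_nat[of "p - 1" n] gcd_p_minus_1_n by metis
  have sub: "fst ` ?A \<subseteq> {c. c ^ ?u = inverse ((z ^ n) ^ y)}"
  proof (rule image_subsetI)
    fix a assume "a \<in> ?A"
    then obtain c i where a: "a = (c, i)" and c: "c \<in> Fp" "c \<noteq> 0" "z = c * \<theta> ^ i"
      by blast
    have "(\<theta> ^ i) ^ n = (\<theta> ^ n) ^ i" by (simp add: mult.commute flip: power_mult)
    hence zn: "z ^ n = c ^ n" using c \<theta>_power by (simp add: power_mult_distrib)
    have "c ^ (p - 1) = 1" using Fp.power_card_F[OF c(1,2)] by (simp add: card_Fp)
    hence "(c ^ n) ^ y * c ^ ?u = 1"
      using arg_cong[OF xy, of "\<lambda>j. c ^ j"] by (simp add: power_add power_mult)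
    hence "inverse ((c ^ n) ^ y) = c ^ ?u" by (rule inverse_unique)
    thus "fst a \<in> {c. c ^ ?u = inverse ((z ^ n) ^ y)}" unfolding zn a by simp
  qed
  have "inj_on fst ?A"
  proof (rule inj_onI)
    fix a b assume "a \<in> ?A" "b \<in> ?A" "fst a = fst b"
    then obtain c i j where "a = (c, i)" "b = (c, j)" "i < n" "j < n" "c * \<theta> ^ i = c * \<theta> ^ j" "c \<noteq> 0"
      by fastforce
    thus "a = b" using \<theta>_power_inj[of i j] by simp
  qed
  hence "card ?A = card (fst ` ?A)" by (simp add: card_image)
  also have "\<dots> \<le> card {c. c ^ ?u = inverse ((z ^ n) ^ y)}"
    by (rule card_mono[OF card_power_roots_le(1)[OF u] sub])
  also have "\<dots> \<le> ?u" by (rule card_power_roots_le(2)[OF u])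
  finally show ?thesis .
qed

text \<open>The fibres over the q - 1 nonzero elements partition (p - 1) n = (q - 1) u pairs; since
  none exceeds u, none can fall below it.\<close>

lemma card_scaled_power_fibre:
  assumes z: "z \<in> Fq - {0}"
  shows "card {(c, i). c \<in> Fp - {0} \<and> i < n \<and> c * \<theta> ^ i = z} = (p - 1) div N"
proof (rule ccontr)
  let ?A = "\<lambda>z. {(c, i). c \<in> Fp - {0} \<and> i < n \<and> c * \<theta> ^ i = z}" and ?u = "(p - 1) div N"
  assume "card (?A z) \<noteq> ?u"
  hence "card (?A z) < ?u" using card_scaled_power_fibre_le[of z] z by simp
  hence "(\<Sum>z\<in>Fq - {0}. card (?A z)) < (\<Sum>z\<in>Fq - {0}. ?u)"
    using z card_scaled_power_fibre_le by (intro sum_strict_mono_ex1) (auto simp: Fq.fin_F)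
  also have "\<dots> = (q - 1) * ?u" by (simp add: card_Fq Fq.zero_F)
  also have "\<dots> = (N * n) * ?u" by (simp only: N_n)
  also have "\<dots> = (N * ?u) * n" by (rule mult.commute[THEN trans]) (simp only: mult_ac)
  also have "\<dots> = (p - 1) * n" using dvd_mult_div_cancel[OF N_dvd] by (simp only:)
  also have "(p - 1) * n = card ((Fp - {0}) \<times> {..<n})"
    by (simp add: card_cartesian_product card_Fp Fp.zero_F)
  also have "\<dots> = (\<Sum>z\<in>Fq - {0}. card {a\<in>(Fp - {0}) \<times> {..<n}. fst a * \<theta> ^ snd a = z})"
    using Fp_subset[of m] \<theta>_in \<theta>_nonzero
    by (intro card_eq_sum_fibres) (auto simp: Fp.fin_F Fq.fin_F intro!: Fq.mult_F Fq.power_F)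
  also have "\<dots> = (\<Sum>z\<in>Fq - {0}. card (?A z))"
    by (intro sum.cong arg_cong[where f = card]) auto
  finally show False by simp
qed

text \<open>Count the pairs (c, i) for which P holds at c \<theta>^i: by invariance c is arbitrary,
  and each admissible z arises from (p - 1)/N pairs. This replaces the powers of \<theta> by all
  nonzero z.\<close>

lemma card_powers_invariant:
  assumes P: "\<And>c z. c \<in> Fp - {0} \<Longrightarrow> z \<in> Fq - {0} \<Longrightarrow> P (c * z) \<longleftrightarrow> P z"
  shows "N * card {i. i < n \<and> P (\<theta> ^ i)} = card {z \<in> Fq - {0}. P z}"
proof -
  let ?u = "(p - 1) div N" and ?I = "{i. i < n \<and> P (\<theta> ^ i)}" and ?Z = "{z \<in> Fq - {0}. P z}"
  have \<theta>F: "\<theta> ^ i \<in> Fq - {0}" for i using \<theta>_in \<theta>_nonzero by (auto intro: Fq.power_F)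
  have u: "?u > 0" using N_dvd N_pos p_ge_2 by (simp add: dvd_imp_le div_greater_zero_iff)
  have "(N * card ?I) * ?u = (N * ?u) * card ?I" by (simp only: mult_ac)
  also have "\<dots> = (p - 1) * card ?I" using dvd_mult_div_cancel[OF N_dvd] by (simp only:)
  also have "\<dots> = card ((Fp - {0}) \<times> ?I)"
    by (simp add: card_cartesian_product card_Fp Fp.zero_F)
  also have "\<dots> = (\<Sum>z\<in>?Z. card {a\<in>(Fp - {0}) \<times> ?I. fst a * \<theta> ^ snd a = z})"
  proof (rule card_eq_sum_fibres)
    show "(\<lambda>a. fst a * \<theta> ^ snd a) ` ((Fp - {0}) \<times> ?I) \<subseteq> ?Z"
    proof (rule image_subsetI)
      fix a assume "a \<in> (Fp - {0}) \<times> ?I"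
      moreover from this have "fst a * \<theta> ^ snd a \<in> Fq - {0}"
        using Fp_subset[of m] \<theta>F[of "snd a"] by (auto intro!: Fq.mult_F)
      ultimately show "fst a * \<theta> ^ snd a \<in> ?Z"
        using P[of "fst a" "\<theta> ^ snd a"] \<theta>F[of "snd a"] by auto
    qed
  qed (auto simp: Fp.fin_F Fq.fin_F)
  also have "\<dots> = (\<Sum>z\<in>?Z. card {(c, i). c \<in> Fp - {0} \<and> i < n \<and> c * \<theta> ^ i = z})"
    using P \<theta>F by (intro sum.cong arg_cong[where f = card]) auto
  also have "\<dots> = (\<Sum>z\<in>?Z. ?u)"
    by (intro sum.cong refl card_scaled_power_fibre) simp
  also have "\<dots> = card ?Z * ?u" by simp
  finally have "(N * card ?I) * ?u = card ?Z * ?u" .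
  thus ?thesis using u by simp
qed

subsection \<open>Double counting\<close>

definition pscale :: "'k \<Rightarrow> 'k \<times> 'k \<Rightarrow> 'k \<times> 'k" where
  "pscale c v = (c * fst v, c * snd v)"

sublocale pair: finite_subfield_module Fp pscale
  by unfold_locales (simp_all add: module_def pscale_def algebra_simps prod_eq_iff)

text \<open>The symbol over \<open>Fq\<close> at position (x, y), before the descent, of the
  codeword with parameters h = (a, b).\<close>

definition form :: "'k \<times> 'k \<Rightarrow> 'k \<Rightarrow> 'k \<Rightarrow> 'k" where
  "form h x y = fst h * Q x + Tr (snd h * y)"

lemma form_diff: "form (h - h') x y = form h x y - form h' x y"
  by (simp add: form_def trace_diff left_diff_distrib)

lemma form_pscale: "c \<in> Fp \<Longrightarrow> form (pscale c h) x y = c * form h x y"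
  using trace_scale[of c m m2 "snd h * y"] Fp_subset[of m]
  by (auto simp: form_def pscale_def algebra_simps)

lemma form_in: "h \<in> Fq \<times> L \<Longrightarrow> x \<in> K \<Longrightarrow> y \<in> L \<Longrightarrow> form h x y \<in> Fq"
  by (auto simp: form_def intro!: Fq.add_F Fq.mult_F Q_in Tr_in L.mult_F)

text \<open>Unlike in \<open>idx\<close>, the position (0, 0) is kept; every form vanishes there, so
  it adds the same amount to the zeros and to the total.\<close>

definition triples :: "('k \<times> 'k \<times> 'k) set" where "triples = K \<times> L \<times> (Fq - {0})"

lemma finite_triples: "finite triples"
  by (simp add: triples_def K.fin_F L.fin_F Fq.fin_F)

lemma card_triples: "card triples = p ^ (m * m1) * p ^ (m * m2) * (q - 1)"
  by (simp add: triples_def card_cartesian_product card_K card_L card_Fq Fq.zero_F)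

definition zero_triples :: "('k \<times> 'k) set \<Rightarrow> ('k \<times> 'k \<times> 'k) set" where
  "zero_triples H = {(x, y, z) \<in> triples. \<forall>h\<in>H. tr (z * form h x y) = 0}"

definition kernel :: "'k \<times> 'k \<Rightarrow> ('k \<times> 'k \<times> 'k) set" where
  "kernel h = {(x, y, z) \<in> triples. tr (z * form h x y) = 0}"

lemma card_kernel_eq_sum:
  "card (kernel h) = (\<Sum>x\<in>K. \<Sum>z\<in>Fq - {0}. card {y\<in>L. tr (z * form h x y) = 0})"
proof -
  have "bij_betw (\<lambda>((x, z), y). (x, y, z))
      (SIGMA (x, z):K \<times> (Fq - {0}). {y\<in>L. tr (z * form h x y) = 0}) (kernel h)"
    by (rule bij_betwI[where g = "\<lambda>(x, y, z). ((x, z), y)"]) (auto simp: kernel_def triples_def)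
  hence "card (kernel h) = card (SIGMA (x, z):K \<times> (Fq - {0}). {y\<in>L. tr (z * form h x y) = 0})"
    by (simp add: bij_betw_same_card)
  also have "\<dots> = (\<Sum>(x, z)\<in>K \<times> (Fq - {0}). card {y\<in>L. tr (z * form h x y) = 0})"
    by (subst card_SigmaI) (auto simp: K.fin_F Fq.fin_F L.fin_F case_prod_beta)
  finally show ?thesis by (simp add: sum.cartesian_product)
qed

lemma card_kernel_0: "card (kernel 0) = card triples"
  by (auto simp: kernel_def form_def trace_0 tr_0 triples_def intro!: arg_cong[where f = card])

text \<open>For fixed x and z the term with Q only shifts the value prescribed for a nonzero
  functional of y, and each value is taken by one y in p.\<close>

lemma card_kernel_generic:
  assumes "h \<in> Fq \<times> L" "snd h \<noteq> 0"
  shows "p * card (kernel h) = card triples"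
proof -
  have "p * card {y\<in>L. tr (z * form h x y) = 0} = p ^ (m * m2)"
    if "x \<in> K" "z \<in> Fq - {0}" for x z
  proof -
    have "tr (z * form h x y) = 0 \<longleftrightarrow> tr (z * Tr (snd h * y)) = - tr (z * (fst h * Q x))" for y
      by (simp add: form_def distrib_left tr_add eq_neg_iff_add_eq_0 add.commute)
    moreover have "- tr (z * (fst h * Q x)) \<in> Fp"
      using that assms by (auto intro!: Fp.uminus_F tr_in Fq.mult_F Q_in)
    ultimately show ?thesis
      using card_Tr_fibre[of z "snd h"] that assms by (auto simp: mem_Times_iff)
  qed
  hence "p * card (kernel h) = (\<Sum>x\<in>K. \<Sum>z\<in>Fq - {0}. p ^ (m * m2))"
    unfolding card_kernel_eq_sum sum_distrib_left by (intro sum.cong refl) auto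
  thus ?thesis
    by (simp add: card_triples card_K card_Fq Fq.zero_F mult_ac)
qed

text \<open>Here y is free. A zero x of Q admits all q - 1 values of z, any other x admits q/p - 1,
  since z = 0 is excluded. The count is the same for every nonzero a.\<close>

lemma card_kernel_Q:
  assumes "h \<in> Fq \<times> L" "snd h = 0" "h \<noteq> 0"
  shows "int p * int (card (kernel h)) = int p ^ (m * m2) *
    (int zeros * int p * (int q - 1) + (int p ^ (m * m1) - int zeros) * (int q - int p))"
proof -
  have a: "fst h \<in> Fq" "fst h \<noteq> 0" using assms by (auto simp: prod_eq_iff)
  let ?c = "\<lambda>x. card {z \<in> Fq - {0}. tr (z * (fst h * Q x)) = 0}"
  have c: "int p * int (?c x) = (if Q x = 0 then int p * (int q - 1) else int q - int p)"
    if x: "x \<in> K" for x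
  proof (cases "Q x = 0")
    case True
    hence "{z \<in> Fq - {0}. tr (z * (fst h * Q x)) = 0} = Fq - {0}" by (auto simp: tr_0)
    hence "?c x = q - 1" by (simp add: card_Fq Fq.zero_F)
    thus ?thesis using True q_ge_2 by (simp add: of_nat_diff)
  next
    case False
    have "p * card {z \<in> Fq. tr (z * (fst h * Q x)) = 0} = q"
      using a False Q_in[OF x] by (intro card_tr_fibre Fq.mult_F Fp.zero_F) auto
    moreover have "{z \<in> Fq. tr (z * (fst h * Q x)) = 0} =
        insert 0 {z \<in> Fq - {0}. tr (z * (fst h * Q x)) = 0}"
      by (auto simp: Fq.zero_F tr_0)
    ultimately have "p * Suc (?c x) = q" by (simp add: Fq.fin_F)
    hence "int (p * Suc (?c x)) = int q" by (simp only:)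
    thus ?thesis using False by (simp add: algebra_simps)
  qed
  have "card (kernel h) = (\<Sum>x\<in>K. p ^ (m * m2) * ?c x)"
  proof -
    have "(\<Sum>z\<in>Fq - {0}. card {y\<in>L. tr (z * form h x y) = 0}) = p ^ (m * m2) * ?c x" for x
    proof -
      have "(\<Sum>z\<in>Fq - {0}. card {y\<in>L. tr (z * form h x y) = 0}) =
          (\<Sum>z\<in>Fq - {0}. if tr (z * (fst h * Q x)) = 0 then p ^ (m * m2) else 0)"
        using assms by (intro sum.cong) (auto simp: form_def trace_0 card_L)
      thus ?thesis by (simp add: Fq.fin_F flip: sum.inter_filter)
    qed
    thus ?thesis unfolding card_kernel_eq_sum by simp
  qed
  hence "int p * int (card (kernel h)) = int p ^ (m * m2) * (\<Sum>x\<in>K. int p * int (?c x))"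
    by (simp add: sum_distrib_left mult_ac)
  also have "(\<Sum>x\<in>K. int p * int (?c x)) =
      (\<Sum>x\<in>K. if Q x = 0 then int p * (int q - 1) else int q - int p)"
    by (intro sum.cong refl c)
  also have "\<dots> = int (card (K \<inter> {x. Q x = 0})) * (int p * (int q - 1)) +
      int (card (K \<inter> - {x. Q x = 0})) * (int q - int p)"
    by (simp add: sum.If_cases K.fin_F)
  also have "card (K \<inter> {x. Q x = 0}) = zeros"
    by (simp add: zeros_def Int_def)
  also have "int (card (K \<inter> - {x. Q x = 0})) = int p ^ (m * m1) - int zeros"
  proof -
    have "card (K \<inter> - {x. Q x = 0}) + card (K \<inter> {x. Q x = 0}) = card K"
      by (subst card_Un_disjoint[symmetric]) (auto simp: K.fin_F intro!: arg_cong[where f = card])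
    hence "int (card (K \<inter> - {x. Q x = 0}) + zeros) = int (p ^ (m * m1))"
      using \<open>card (K \<inter> {x. Q x = 0}) = zeros\<close> card_K by simp
    thus ?thesis by simp
  qed
  finally show ?thesis by (simp add: mult.assoc)
qed

definition Q_part :: "('k \<times> 'k) set \<Rightarrow> nat" where
  "Q_part H = card {h\<in>H. snd h = 0}"

text \<open>For a fixed triple, h |-> tr(z form(h)) vanishes on all of \<open>H\<close> or on
  exactly one p-th of it; for fixed h the count is the size of \<open>kernel h\<close>. Equating the
  two summations, each multiplied by p, leaves a common factor p - 1.\<close>

lemma card_zero_triples:
  assumes H: "pair.lin_closed H" "H \<subseteq> Fq \<times> L"
  shows "int (card (zero_triples H)) * int (card H) = int (card triples) +
    (int (Q_part H) - 1) * int p ^ (m * m2) * (int q * int zeros - int p ^ (m * m1))"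
proof -
  have finH: "finite H" using H(2) Fq.fin_F L.fin_F finite_subset by blast
  let ?T = "int (card triples)" and ?A = "int (card (zero_triples H))" and ?H = "int (card H)"
  let ?P = "\<lambda>(x, y, z) h. tr (z * form h x y) = 0"
  \<comment> \<open>\<open>?k\<close> is p times the size of \<open>kernel h\<close> shared by all
    nonzero pairs (a, 0).\<close>
  let ?k = "int p ^ (m * m2) *
    (int zeros * int p * (int q - 1) + (int p ^ (m * m1) - int zeros) * (int q - int p))"
  have row: "int p * int (card {h\<in>H. ?P t h}) = (if t \<in> zero_triples H then int p * ?H else ?H)"
    if t: "t \<in> triples" for t
  proof -
    obtain x y z where xyz: "t = (x, y, z)" "x \<in> K" "y \<in> L" "z \<in> Fq"
      using t by (auto simp: triples_def)
    show ?thesis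
    proof (cases "t \<in> zero_triples H")
      case True
      hence "{h\<in>H. ?P t h} = H" by (auto simp: zero_triples_def xyz)
      thus ?thesis using True by simp
    next
      case False
      then obtain w where w: "w \<in> H" "tr (z * form w x y) \<noteq> 0"
        using t by (auto simp: zero_triples_def xyz)
      have "card Fp * card {h\<in>H. tr (z * form h x y) = 0} = card H"
      proof (rule pair.card_functional_fibre[OF H(1) finH])
        fix h assume "h \<in> H"
        thus "tr (z * form h x y) \<in> Fp" using H(2) xyz by (auto intro!: tr_in Fq.mult_F form_in)
        fix a assume a: "a \<in> Fp"
        thus "tr (z * form (pscale a h) x y) = a * tr (z * form h x y)"
          using tr_scale[OF a, of "z * form h x y"] by (simp add: form_pscale mult.left_commute)
      qed (use w in \<open>auto simp: form_diff right_diff_distrib tr_diff Fp.zero_F\<close>)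
      hence "int (p * card {h\<in>H. ?P t h}) = ?H" by (simp only: card_Fp xyz case_prod_conv)
      thus ?thesis using False by simp
    qed
  qed
  have "(\<Sum>t\<in>triples. int p * int (card {h\<in>H. ?P t h})) =
      (\<Sum>t\<in>triples. if t \<in> zero_triples H then int p * ?H else ?H)"
    by (intro sum.cong refl row)
  also have "\<dots> = ?A * (int p * ?H) + (?T - ?A) * ?H"
  proof -
    have sub: "zero_triples H \<subseteq> triples" by (auto simp: zero_triples_def)
    hence "triples \<inter> {t. t \<in> zero_triples H} = zero_triples H"
      "triples \<inter> - {t. t \<in> zero_triples H} = triples - zero_triples H" by auto
    moreover have "int (card (triples - zero_triples H)) = ?T - ?A"
      using sub finite_triples by (simp add: card_Diff_subset finite_subset card_mono of_nat_diff)
    ultimately show ?thesis by (simp add: sum.If_cases finite_triples)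
  qed
  finally have rows: "(\<Sum>t\<in>triples. int p * int (card {h\<in>H. ?P t h})) =
    ?A * (int p * ?H) + (?T - ?A) * ?H" .
  have "(\<Sum>t\<in>triples. card {h\<in>H. ?P t h}) = (\<Sum>h\<in>H. card {t\<in>triples. ?P t h})"
    using sum.swap_restrict[OF finite_triples finH, of "\<lambda>_ _. 1::nat" ?P] by simp
  also have "\<dots> = (\<Sum>h\<in>H. card (kernel h))"
    by (intro sum.cong arg_cong[where f = card] refl) (auto simp: kernel_def)
  finally have "(\<Sum>t\<in>triples. int p * int (card {h\<in>H. ?P t h})) = (\<Sum>h\<in>H. int p * int (card (kernel h)))"
    by (simp flip: sum_distrib_left of_nat_sum)
  also have "\<dots> = (\<Sum>h\<in>H. if snd h = 0 then (if h = 0 then int p * ?T else ?k) else ?T)"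
  proof (intro sum.cong refl)
    fix h assume "h \<in> H"
    hence h: "h \<in> Fq \<times> L" using H by blast
    show "int p * int (card (kernel h)) = (if snd h = 0 then (if h = 0 then int p * ?T else ?k) else ?T)"
      using card_kernel_Q[OF h] card_kernel_generic[OF h] card_kernel_0
      by (auto simp flip: of_nat_mult)
  qed
  also have "\<dots> = (\<Sum>h\<in>{h\<in>H. snd h = 0}. if h = 0 then int p * ?T else ?k) + (?H - int (Q_part H)) * ?T"
  proof -
    have "H \<inter> - {h. snd h = 0} = H - {h\<in>H. snd h = 0}" by auto
    moreover have "int (card (H - {h\<in>H. snd h = 0})) = ?H - int (Q_part H)"
      using finH by (simp add: card_Diff_subset Q_part_def card_mono of_nat_diff)
    ultimately show ?thesis by (simp add: sum.If_cases finH Int_def)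
  qed
  also have "(\<Sum>h\<in>{h\<in>H. snd h = 0}. if h = 0 then int p * ?T else ?k) = int p * ?T + (int (Q_part H) - 1) * ?k"
  proof -
    have 0: "0 \<in> {h\<in>H. snd h = 0}" using H(1) by (simp add: pair.lin_closed_zero)
    have fin: "finite {h\<in>H. snd h = 0}" using finH by simp
    have "int (card ({h\<in>H. snd h = 0} - {0})) = int (Q_part H) - 1"
      using card.remove[OF fin 0] by (simp add: Q_part_def)
    thus ?thesis by (simp add: sum.remove[OF fin 0])
  qed
  finally have "?A * (int p * ?H) + (?T - ?A) * ?H =
      int p * ?T + (int (Q_part H) - 1) * ?k + (?H - int (Q_part H)) * ?T"
    unfolding rows .
  \<comment> \<open>The excess over the generic value \<open>?T\<close> is governed by the deviation
    of the zeros of Q from their average, and it contains the factor p - 1 that cancels.\<close>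
  moreover have "?k = ?T + (int p - 1) * (int p ^ (m * m2) * (int q * int zeros - int p ^ (m * m1)))"
    using q_ge_2 by (simp add: card_triples of_nat_diff) (simp add: algebra_simps)
  ultimately have "(int p - 1) * (?A * ?H) = (int p - 1) * (?T +
      (int (Q_part H) - 1) * int p ^ (m * m2) * (int q * int zeros - int p ^ (m * m1)))"
    by (simp add: algebra_simps)
  thus ?thesis using p_ge_2 by simp
qed

end

section \<open>Generalised Hamming weights of the descended code\<close>

context descended_code
begin

abbreviation I :: "(('k \<times> 'k) \<times> nat) set" where "I \<equiv> idx p m m1 m2 N"
abbreviation code :: "(('k \<times> 'k) \<times> nat \<Rightarrow> 'k) set" where "code \<equiv> code_QN p m m1 m2 N Q \<theta>"

section \<open>Subcodes as images of subspaces of \<open>Fq \<times> L\<close>\<close>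

definition codeword :: "'k \<times> 'k \<Rightarrow> ('k \<times> 'k) \<times> nat \<Rightarrow> 'k" where
  "codeword h = (\<lambda>((x, y), i). if ((x, y), i) \<in> I then tr (form h x y * \<theta> ^ i) else 0)"

lemma code_eq: "code = codeword ` (Fq \<times> L)"
proof -
  have cw: "codeword (a, b) = (\<lambda>((x, y), i). if ((x, y), i) \<in> I
      then trace p 1 m ((a * Q x + Tr (b * y)) * \<theta> ^ i) else 0)" for a b
    by (auto simp: codeword_def form_def tr_def fun_eq_iff)
  show ?thesis unfolding code_QN_def cw[symmetric] by auto
qed

lemma codeword_0: "codeword 0 j = 0"
  by (simp add: codeword_def form_def trace_0 tr_0 split: prod.split)

lemma codeword_add: "codeword (h + h') j = codeword h j + codeword h' j"
  by (simp add: codeword_def form_def trace_add tr_add algebra_simps split: prod.split)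

lemma codeword_pscale: "c \<in> Fp \<Longrightarrow> codeword (pscale c h) j = c * codeword h j"
  by (simp add: codeword_def form_pscale tr_scale mult.assoc split: prod.split)

lemma codeword_sum:
  fixes r :: nat
  assumes "\<And>i. i < r \<Longrightarrow> c i \<in> Fp"
  shows "codeword (\<Sum>i<r. pscale (c i) (v i)) j = (\<Sum>i<r. c i * codeword (v i) j)"
  using assms by (induction r) (simp_all add: codeword_0 codeword_add codeword_pscale)

lemma tr_zero_invariant:
  "c \<in> Fp - {0} \<Longrightarrow> tr (u * (c * z)) = 0 \<longleftrightarrow> tr (u * z) = 0"
  by (simp add: mult.left_commute[of u c] tr_scale)

lemma finite_I: "finite I"
  by (simp add: idx_def K.fin_F L.fin_F)

text \<open>If a symbol u were nonzero, vanishing of its whole block would give tr(u z) = 0 for all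
  z in \<open>Fq\<close>, which is impossible. So all symbols vanish; a position (x, 0) with Q x
  nonzero then kills a, and a position (0, y) kills b.\<close>

lemma codeword_inj:
  assumes h: "h \<in> Fq \<times> L" and 0: "codeword h = (\<lambda>j. 0)"
  shows "h = 0"
proof -
  obtain w where w: "w \<in> Fq" "tr w \<noteq> 0" using tr_nonzero by blast
  have form0: "form h x y = 0" if xy: "x \<in> K" "y \<in> L" "(x, y) \<noteq> (0, 0)" for x y
  proof (rule ccontr)
    assume nz: "form h x y \<noteq> 0"
    let ?u = "form h x y"
    have "tr (?u * \<theta> ^ i) = 0" if "i < n" for i
    proof -
      have "((x, y), i) \<in> I" using xy that by (auto simp: idx_def)
      thus ?thesis using fun_cong[OF 0, of "((x, y), i)"] by (simp add: codeword_def)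
    qed
    hence "{i. i < n \<and> tr (?u * \<theta> ^ i) = 0} = {..<n}" by auto
    hence "q - 1 = card {z \<in> Fq - {0}. tr (?u * z) = 0}"
      using card_powers_invariant[of "\<lambda>z. tr (?u * z) = 0"] tr_zero_invariant N_n by simp
    hence "{z \<in> Fq - {0}. tr (?u * z) = 0} = Fq - {0}"
      by (intro card_subset_eq) (auto simp: Fq.fin_F card_Fq Fq.zero_F)
    moreover have "w / ?u \<in> Fq - {0}"
      using w nz tr_0 form_in[OF h xy(1,2)] by (auto intro!: Fq.divide_F)
    ultimately have "tr (?u * (w / ?u)) = 0" by blast
    thus False using w nz by simp
  qed
  obtain x where x: "x \<in> K" "Q x \<noteq> 0" using Q_nonzero by blast
  hence "x \<noteq> 0" using Q_0 by auto
  hence fst: "fst h = 0"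
    using form0[OF x(1) L.zero_F] x by (simp add: form_def trace_0)
  obtain y where y: "y \<in> L" "Tr y \<noteq> 0"
    using trace_nonzero[OF m_ge_1 m2_ge_1 card_L] by blast
  have "snd h = 0"
  proof (rule ccontr)
    assume nz: "snd h \<noteq> 0"
    have "y \<noteq> 0" using y trace_0 by auto
    moreover have "y / snd h \<in> L" using y h by (auto intro!: L.divide_F)
    ultimately have "form h 0 (y / snd h) = 0" using form0[OF K.zero_F] nz by simp
    thus False using nz y by (simp add: form_def Q_0)
  qed
  thus ?thesis using fst by (simp add: prod_eq_iff)
qed

lemma lin_closed_Fq_L: "pair.lin_closed (Fq \<times> L)"
  using Fp_subset[of m] Fp_subset[of "m * m2"]
  by (auto simp: pair.lin_closed_def pscale_def zero_prod_def Fq.zero_F L.zero_F Fq.add_F L.add_F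
      intro!: Fq.mult_F L.mult_F)

lemma finite_Fq_L: "finite (Fq \<times> L)"
  by (simp add: Fq.fin_F L.fin_F)

lemma card_Fq_L: "card (Fq \<times> L) = p ^ (m + m * m2)"
  by (simp add: card_cartesian_product card_Fq card_L power_add)

lemma codeword_image_lspan:
  "cw_span Fp (\<lambda>i. codeword (v i)) r = codeword ` pair.lspan v r"
proof -
  let ?C = "{c. \<forall>i<r. c i \<in> Fp}"
  have "cw_span Fp (\<lambda>i. codeword (v i)) r = (\<lambda>c j. \<Sum>i<r. c i * codeword (v i) j) ` ?C"
    unfolding cw_span_def by blast
  also have "\<dots> = (\<lambda>c. codeword (\<Sum>i<r. pscale (c i) (v i))) ` ?C"
    by (intro image_cong refl ext) (simp add: codeword_sum)
  also have "\<dots> = codeword ` pair.lspan v r"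
    unfolding pair.lspan_def by blast
  finally show ?thesis .
qed

lemma cw_indep_codeword:
  assumes v: "\<And>i. i < r \<Longrightarrow> v i \<in> Fq \<times> L"
  shows "cw_indep Fp (\<lambda>i. codeword (v i)) r \<longleftrightarrow> pair.indep v r"
proof -
  have "(\<lambda>j. \<Sum>i<r. c i * codeword (v i) j) = (\<lambda>j. 0) \<longleftrightarrow> (\<Sum>i<r. pscale (c i) (v i)) = 0"
    if c: "\<forall>i<r. c i \<in> Fp" for c
  proof -
    have eq: "(\<lambda>j. \<Sum>i<r. c i * codeword (v i) j) = codeword (\<Sum>i<r. pscale (c i) (v i))"
      using c by (intro ext) (simp add: codeword_sum)
    have mem: "(\<Sum>i<r. pscale (c i) (v i)) \<in> Fq \<times> L"
      by (intro pair.lin_closed_sum[OF lin_closed_Fq_L] pair.lin_closed_scale[OF lin_closed_Fq_L])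
        (use c v in simp_all)
    show ?thesis unfolding eq
    proof
      assume "(\<Sum>i<r. pscale (c i) (v i)) = 0"
      thus "codeword (\<Sum>i<r. pscale (c i) (v i)) = (\<lambda>j. 0)" by (simp add: codeword_0 fun_eq_iff)
    qed (rule codeword_inj[OF mem])
  qed
  thus ?thesis unfolding cw_indep_def pair.indep_def by blast
qed

text \<open>By injectivity of \<open>codeword\<close>, independence can be tested on the parameters
  (a, b).\<close>

lemma subspaces_dim_eq:
  "subspaces_dim Fp code r =
    {codeword ` pair.lspan v r | v. (\<forall>i<r. v i \<in> Fq \<times> L) \<and> pair.indep v r}"
proof (intro equalityI subsetI)
  fix S assume "S \<in> subspaces_dim Fp code r"
  then obtain w where w: "\<forall>i<r. w i \<in> code" "cw_indep Fp w r" "S = cw_span Fp w r"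
    by (auto simp: subspaces_dim_def)
  hence "\<forall>i. \<exists>h. i < r \<longrightarrow> h \<in> Fq \<times> L \<and> w i = codeword h" unfolding code_eq by blast
  then obtain v where v: "\<And>i. i < r \<Longrightarrow> v i \<in> Fq \<times> L" "\<And>i. i < r \<Longrightarrow> w i = codeword (v i)"
    by metis
  have "cw_span Fp w r = cw_span Fp (\<lambda>i. codeword (v i)) r"
    by (simp add: cw_span_def v(2))
  moreover have "cw_indep Fp w r = cw_indep Fp (\<lambda>i. codeword (v i)) r"
    by (simp add: cw_indep_def v(2))
  ultimately show "S \<in> {codeword ` pair.lspan v r | v. (\<forall>i<r. v i \<in> Fq \<times> L) \<and> pair.indep v r}"
    using w v(1) cw_indep_codeword[of r v, OF v(1)] codeword_image_lspan by auto
next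
  fix S assume "S \<in> {codeword ` pair.lspan v r | v. (\<forall>i<r. v i \<in> Fq \<times> L) \<and> pair.indep v r}"
  then obtain v where v: "\<And>i. i < r \<Longrightarrow> v i \<in> Fq \<times> L" "pair.indep v r" "S = codeword ` pair.lspan v r"
    by blast
  thus "S \<in> subspaces_dim Fp code r"
    using cw_indep_codeword[of r v, OF v(1)] codeword_image_lspan[of v r]
    unfolding subspaces_dim_def by (intro CollectI exI[of _ "\<lambda>i. codeword (v i)"]) (auto simp: code_eq)
qed

lemma card_supp:
  "N * card (supp I (codeword ` H)) + card (zero_triples H) = card triples"
proof -
  let ?P = "\<lambda>x y z. \<forall>h\<in>H. tr (form h x y * z) = 0"
  define Z where "Z = (SIGMA (x, y):K \<times> L. {i. i < n \<and> ?P x y (\<theta> ^ i)})"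
  have sub: "Z \<subseteq> (K \<times> L) \<times> {..<n}" by (auto simp: Z_def)
  \<comment> \<open>Every form vanishes at (0, 0), so restoring this position does not enlarge the
    support.\<close>
  have "form h 0 0 = 0" for h by (simp add: form_def Q_0 trace_0)
  hence "supp I (codeword ` H) = (K \<times> L) \<times> {..<n} - Z"
    by (auto simp: supp_def Z_def idx_def codeword_def tr_0 split: if_splits)
  moreover have fin: "finite ((K \<times> L) \<times> {..<n})" by (simp add: K.fin_F L.fin_F)
  ultimately have "card (supp I (codeword ` H)) + card Z = card ((K \<times> L) \<times> {..<n})"
    using sub by (simp add: card_Diff_subset finite_subset card_mono)
  hence "N * card (supp I (codeword ` H)) + N * card Z = N * (card (K \<times> L) * n)"
    by (simp add: card_cartesian_product flip: distrib_left)
  also have "\<dots> = card triples"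
    using N_n by (simp add: card_triples card_cartesian_product card_K card_L)
  also have "N * card Z = card (zero_triples H)"
  proof -
    have "N * card {i. i < n \<and> ?P x y (\<theta> ^ i)} = card {z \<in> Fq - {0}. ?P x y z}" for x y
      by (rule card_powers_invariant) (simp add: tr_zero_invariant)
    hence "N * card Z = (\<Sum>(x, y)\<in>K \<times> L. card {z \<in> Fq - {0}. ?P x y z})"
      unfolding Z_def
      by (subst card_SigmaI) (auto simp: K.fin_F L.fin_F sum_distrib_left case_prod_beta intro!: sum.cong)
    also have "\<dots> = card (SIGMA (x, y):K \<times> L. {z \<in> Fq - {0}. ?P x y z})"
      by (subst card_SigmaI) (auto simp: K.fin_F L.fin_F Fq.fin_F case_prod_beta)
    also have "\<dots> = card (zero_triples H)"
    proof (rule bij_betw_same_card)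
      show "bij_betw (\<lambda>((x, y), z). (x, y, z)) (SIGMA (x, y):K \<times> L. {z \<in> Fq - {0}. ?P x y z}) (zero_triples H)"
        by (rule bij_betwI[where g = "\<lambda>(x, y, z). ((x, y), z)"])
          (auto simp: zero_triples_def triples_def mult.commute)
    qed
    finally show ?thesis .
  qed
  finally show ?thesis .
qed

text \<open>Normalised so that \<open>Q\<close> has \<open>q\<^bsup>m1 - 1\<^esup> (1 + (q - 1) bias)\<close> zeros.\<close>

definition bias :: real where
  "bias = (real q * real zeros - real q ^ m1) / (real q ^ m1 * (real q - 1))"

text \<open>The support size, obtained by solving the double count; \<open>h\<close> is the number
  of a with (a, 0) in the subspace. It is affine in \<open>h\<close>, with slope of sign opposite to
  \<open>bias\<close>.\<close>

definition weight :: "nat \<Rightarrow> nat \<Rightarrow> real" where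
  "weight r h = real q ^ (m1 + m2) * (real q - 1) / (real p ^ r * real N) *
     (real p ^ r - 1 - (real h - 1) * bias)"

lemma card_supp_eq_weight:
  assumes H: "pair.lin_closed H" "H \<subseteq> Fq \<times> L" "card H = p ^ r"
  shows "real (card (supp I (codeword ` H))) = weight r (Q_part H)"
proof -
  let ?s = "real (card (supp I (codeword ` H)))" and ?Z = "real (card (zero_triples H))"
  have q1: "real q > 1" using q_ge_2 by linarith
  have T: "real (card triples) = real q ^ (m1 + m2) * (real q - 1)"
    using q_ge_2 by (simp add: card_triples of_nat_diff power_add power_mult)
  have "real_of_int (int (card (zero_triples H)) * int (card H)) = real_of_int (int (card triples) +
    (int (Q_part H) - 1) * int p ^ (m * m2) * (int q * int zeros - int p ^ (m * m1)))"
    using card_zero_triples[OF H(1,2)] by simp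
  hence "?Z * real p ^ r = real (card triples) +
      (real (Q_part H) - 1) * real q ^ m2 * (real q * real zeros - real q ^ m1)"
    by (simp add: H(3) power_mult)
  also have "real q * real zeros - real q ^ m1 = bias * (real q ^ m1 * (real q - 1))"
    using q1 p_ge_2 by (simp add: bias_def)
  finally have Z: "?Z * real p ^ r =
      real (card triples) * (1 + (real (Q_part H) - 1) * bias)"
    unfolding T by (simp add: algebra_simps power_add)
  have "real N * ?s + ?Z = real (card triples)"
    using card_supp[of H] by (metis of_nat_add of_nat_mult)
  hence "real N * ?s * real p ^ r + ?Z * real p ^ r = real (card triples) * real p ^ r"
    by (metis distrib_right)
  hence "real N * ?s * real p ^ r = real (card triples) * (real p ^ r - 1 - (real (Q_part H) - 1) * bias)"
    unfolding Z by (simp add: algebra_simps)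
  thus ?thesis
    using N_pos p_ge_2 unfolding weight_def T by (simp add: field_simps)
qed

lemma ghw_eqI:
  assumes lower: "\<And>H. pair.lin_closed H \<Longrightarrow> H \<subseteq> Fq \<times> L \<Longrightarrow> card H = p ^ r \<Longrightarrow> D \<le> weight r (Q_part H)"
    and attained: "\<exists>v. pair.indep v r \<and> (\<forall>i<r. v i \<in> Fq \<times> L) \<and> weight r (Q_part (pair.lspan v r)) = D"
  shows "real (ghw Fp I code r) = D"
proof -
  have H: "pair.lin_closed (pair.lspan v r)" "pair.lspan v r \<subseteq> Fq \<times> L" "card (pair.lspan v r) = p ^ r"
    if "pair.indep v r" "\<forall>i<r. v i \<in> Fq \<times> L" for v
    using that pair.lspan_subset[OF lin_closed_Fq_L, of r v]
    by (simp_all add: pair.lin_closed_lspan pair.card_lspan card_Fp)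
  let ?S = "(\<lambda>S. card (supp I S)) ` subspaces_dim Fp code r"
  obtain v where v: "pair.indep v r" "\<forall>i<r. v i \<in> Fq \<times> L" "weight r (Q_part (pair.lspan v r)) = D"
    using attained by blast
  let ?d = "card (supp I (codeword ` pair.lspan v r))"
  have d: "real ?d = D" using card_supp_eq_weight[OF H[OF v(1,2)]] v(3) by simp
  have "ghw Fp I code r = ?d"
    unfolding ghw_def
  proof (rule Min_eqI)
    have "?S \<subseteq> {..card I}" using finite_I by (auto simp: supp_def intro!: card_mono)
    thus "finite ?S" using finite_subset by blast
    show "?d \<in> ?S" using v by (auto simp: subspaces_dim_eq)
    fix y assume "y \<in> ?S"
    then obtain v' where v': "y = card (supp I (codeword ` pair.lspan v' r))"
      "pair.indep v' r" "\<forall>i<r. v' i \<in> Fq \<times> L"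
      by (auto simp: subspaces_dim_eq)
    have "D \<le> real y"
      using lower[OF H[OF v'(2,3)]] card_supp_eq_weight[OF H[OF v'(2,3)]] v'(1) by simp
    thus "?d \<le> y" using d by simp
  qed
  thus ?thesis using d by simp
qed

section \<open>Bounds for \<open>Q_part\<close>, extremal subspaces and the minimum\<close>

lemma Q_part_bounds:
  assumes H: "pair.lin_closed H" "H \<subseteq> Fq \<times> L"
  shows "Q_part H \<ge> 1" "Q_part H \<le> card H" "Q_part H \<le> q" "card H = card (snd ` H) * Q_part H"
proof -
  have fin: "finite H" using H(2) finite_Fq_L finite_subset by blast
  have "0 \<in> {h\<in>H. snd h = 0}" using H(1) by (simp add: pair.lin_closed_zero)
  hence "{h\<in>H. snd h = 0} \<noteq> {}" by blast
  moreover have "finite {h\<in>H. snd h = 0}" using fin by simp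
  ultimately have "card {h\<in>H. snd h = 0} > 0" by (simp only: card_gt_0_iff simp_thms)
  thus "Q_part H \<ge> 1" by (simp add: Q_part_def)
  show "Q_part H \<le> card H" using fin by (auto simp: Q_part_def intro: card_mono)
  have "card {h\<in>H. snd h = 0} \<le> card (Fq \<times> {0::'k})"
    using H(2) by (intro card_mono) (auto simp: Fq.fin_F)
  thus "Q_part H \<le> q" by (simp add: Q_part_def card_cartesian_product card_Fq)
  show "card H = card (snd ` H) * Q_part H"
    unfolding Q_part_def by (rule card_additive_image[OF fin pair.lin_closed_diff[OF H(1)]]) simp_all
qed

lemma bias_even_rank:
  assumes "qf_rank p m m1 Q = 2 * k"
  shows "bias = of_int (eps_sign p m m1 Q) / real q ^ k"
proof -
  have q1: "real q > 1" using q_ge_2 by linarith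
  have "real_of_int ((int q * int zeros - int q ^ m1) * int q ^ k) =
      real_of_int (eps_sign p m m1 Q * (int q - 1) * int q ^ m1)"
    using zeros_even_rank[OF assms] by (simp only:)
  hence "(real q * real zeros - real q ^ m1) * real q ^ k =
      of_int (eps_sign p m m1 Q) * (real q - 1) * real q ^ m1"
    by simp
  moreover have "real q ^ m1 * (real q - 1) \<noteq> 0" "real q ^ k \<noteq> 0"
    using q1 p_ge_2 by auto
  moreover have "x / (y * d) = e / c" if "x * c = e * d * y" "y * d \<noteq> 0" "c \<noteq> 0" for x y d e c :: real
    using that by (simp add: frac_eq_eq mult_ac)
  ultimately show ?thesis unfolding bias_def by blast
qed

lemma bias_odd_rank: "odd (qf_rank p m m1 Q) \<Longrightarrow> bias = 0"
  using arg_cong[OF zeros_odd_rank, of real] by (simp add: bias_def)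

lemma weight_mono:
  assumes "(real h' - real h) * bias \<ge> 0"
  shows "weight r h' \<le> weight r h"
proof -
  have "real q > 1" using q_ge_2 by linarith
  hence "real q ^ (m1 + m2) * (real q - 1) / (real p ^ r * real N) \<ge> 0" by simp
  thus ?thesis
    using assms unfolding weight_def by (intro mult_left_mono) (simp_all add: algebra_simps)
qed

lemma lin_closed_Fq_0: "pair.lin_closed (Fq \<times> {0})" and lin_closed_0_L: "pair.lin_closed ({0} \<times> L)"
  using Fp_subset[of m] Fp_subset[of "m * m2"]
  by (auto simp: pair.lin_closed_def pscale_def zero_prod_def Fq.zero_F L.zero_F Fq.add_F L.add_F
      intro!: Fq.mult_F L.mult_F)

text \<open>The subspace is taken comparable with \<open>Fq \<times> {0}\<close>: for r \<le> m it
  lies inside and counts fully, beyond that it contains the whole factor.\<close>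

lemma subspace_max_Q_part:
  assumes "r \<le> m * (m2 + 1)"
  shows "\<exists>v. pair.indep v r \<and> (\<forall>i<r. v i \<in> Fq \<times> L) \<and> Q_part (pair.lspan v r) = p ^ min r m"
proof -
  have "card Fp ^ r \<le> card (Fq \<times> L)"
    using assms p_ge_2 by (simp add: card_Fp card_Fq_L power_increasing algebra_simps)
  moreover have "Fq \<times> {0} \<subseteq> Fq \<times> L" "card (Fq \<times> {0::'k}) = card Fp ^ m"
    using L.zero_F by (auto simp: card_Fp card_Fq card_cartesian_product)
  ultimately obtain v where v: "pair.indep v r" "\<forall>i<r. v i \<in> Fq \<times> L"
    "r \<le> m \<longrightarrow> pair.lspan v r \<subseteq> Fq \<times> {0}" "m \<le> r \<longrightarrow> Fq \<times> {0} \<subseteq> pair.lspan v r"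
    using pair.indep_adapted[OF lin_closed_Fq_0 _ _ lin_closed_Fq_L finite_Fq_L, of m r] by blast
  let ?H = "pair.lspan v r"
  have H: "pair.lin_closed ?H" "?H \<subseteq> Fq \<times> L" "card ?H = p ^ r"
    using v(1,2) pair.lspan_subset[OF lin_closed_Fq_L, of r v]
    by (simp_all add: pair.lin_closed_lspan pair.card_lspan card_Fp)
  have "Q_part ?H = p ^ min r m"
  proof (cases "r \<le> m")
    case True
    hence "{h \<in> ?H. snd h = 0} = ?H" using v(3) by auto
    thus ?thesis using True H(3) by (simp add: Q_part_def)
  next
    case False
    hence "{h \<in> ?H. snd h = 0} = Fq \<times> {0}" using v(4) H(2) by auto
    thus ?thesis using False by (simp add: Q_part_def card_cartesian_product card_Fq)
  qed
  thus ?thesis using v by blast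
qed

text \<open>The subspace is taken comparable with \<open>{0} \<times> L\<close>: inside it, only 0
  has second component 0; once it contains this factor, it projects onto \<open>L\<close> with
  fibres of size p^(r - m m2). Truncated subtraction merges the two cases.\<close>

lemma subspace_min_Q_part:
  assumes "r \<le> m * (m2 + 1)"
  shows "\<exists>v. pair.indep v r \<and> (\<forall>i<r. v i \<in> Fq \<times> L) \<and> Q_part (pair.lspan v r) = p ^ (r - m * m2)"
proof -
  have "card Fp ^ r \<le> card (Fq \<times> L)"
    using assms p_ge_2 by (simp add: card_Fp card_Fq_L power_increasing algebra_simps)
  moreover have "{0} \<times> L \<subseteq> Fq \<times> L" "card ({0::'k} \<times> L) = card Fp ^ (m * m2)"
    using Fq.zero_F by (auto simp: card_Fp card_L card_cartesian_product)
  ultimately obtain v where v: "pair.indep v r" "\<forall>i<r. v i \<in> Fq \<times> L"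
    "r \<le> m * m2 \<longrightarrow> pair.lspan v r \<subseteq> {0} \<times> L" "m * m2 \<le> r \<longrightarrow> {0} \<times> L \<subseteq> pair.lspan v r"
    using pair.indep_adapted[OF lin_closed_0_L _ _ lin_closed_Fq_L finite_Fq_L, of "m * m2" r] by blast
  let ?H = "pair.lspan v r"
  have H: "pair.lin_closed ?H" "?H \<subseteq> Fq \<times> L" "card ?H = p ^ r"
    using v(1,2) pair.lspan_subset[OF lin_closed_Fq_L, of r v]
    by (simp_all add: pair.lin_closed_lspan pair.card_lspan card_Fp)
  have "Q_part ?H = p ^ (r - m * m2)"
  proof (cases "r \<le> m * m2")
    case True
    have "(0, 0) \<in> ?H" using pair.lin_closed_zero[OF H(1)] by (simp add: zero_prod_def)
    hence "{h \<in> ?H. snd h = 0} = {(0, 0)}" using v(3) True by auto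
    thus ?thesis using True by (simp add: Q_part_def)
  next
    case False
    hence "snd ` ?H = L"
      using v(4) H(2) by (force simp: image_iff)
    hence "p ^ (m * m2) * Q_part ?H = p ^ r"
      using Q_part_bounds(4)[OF H(1,2)] H(3) by (simp add: card_L)
    also have "p ^ r = p ^ (m * m2) * p ^ (r - m * m2)"
      using False by (simp flip: power_add)
    finally show ?thesis using p_ge_2 by simp
  qed
  thus ?thesis using v by blast
qed

text \<open>Here a larger \<open>Q_part\<close> never increases the support, so the minimum is
  reached at the largest possible value.\<close>

lemma ghw_bias_nonneg:
  assumes "r \<le> m * (m2 + 1)" "bias \<ge> 0"
  shows "real (ghw Fp I code r) = weight r (p ^ min r m)"
proof (rule ghw_eqI)
  fix H assume H: "pair.lin_closed H" "H \<subseteq> Fq \<times> L" "card H = p ^ r"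
  have "Q_part H \<le> p ^ min r m"
    using Q_part_bounds(2,3)[OF H(1,2)] H(3) by (simp add: min_def)
  hence "real (Q_part H) \<le> real (p ^ min r m)" by (simp only: of_nat_le_iff)
  hence "(real (p ^ min r m) - real (Q_part H)) * bias \<ge> 0" using assms by (intro mult_nonneg_nonneg) auto
  thus "weight r (p ^ min r m) \<le> weight r (Q_part H)"
    by (rule weight_mono)
qed (use subspace_max_Q_part[OF assms(1)] in metis)

text \<open>Here a smaller \<open>Q_part\<close> never increases the support. The projection to
  \<open>L\<close> has at most p^(m m2) elements, which bounds its kernel from below.\<close>

lemma ghw_bias_nonpos:
  assumes "r \<le> m * (m2 + 1)" "bias \<le> 0"
  shows "real (ghw Fp I code r) = weight r (p ^ (r - m * m2))"
proof (rule ghw_eqI)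
  fix H assume H: "pair.lin_closed H" "H \<subseteq> Fq \<times> L" "card H = p ^ r"
  have "p ^ (r - m * m2) \<le> Q_part H"
  proof (cases "r \<le> m * m2")
    case True
    thus ?thesis using Q_part_bounds(1)[OF H(1,2)] by simp
  next
    case False
    have "card (snd ` H) \<le> p ^ (m * m2)"
      unfolding card_L[symmetric] using H(2) by (intro card_mono L.fin_F) auto
    hence "p ^ r \<le> p ^ (m * m2) * Q_part H"
      using Q_part_bounds(4)[OF H(1,2)] H(3) by (metis mult_le_mono1)
    also have "p ^ r = p ^ (m * m2) * p ^ (r - m * m2)"
      using False by (simp flip: power_add)
    finally show ?thesis using p_ge_2 by simp
  qed
  hence "real (p ^ (r - m * m2)) \<le> real (Q_part H)" by (simp only: of_nat_le_iff)
  hence "(real (p ^ (r - m * m2)) - real (Q_part H)) * bias \<ge> 0"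
    using assms by (intro mult_nonpos_nonpos) auto
  thus "weight r (p ^ (r - m * m2)) \<le> weight r (Q_part H)"
    by (rule weight_mono)
qed (use subspace_min_Q_part[OF assms(1)] in metis)

end

theorem theorem5:
  fixes p m m1 m2 N r :: nat and Q :: "'k::field \<Rightarrow> 'k" and \<theta> :: 'k
  assumes "prime p" and "odd p" and "of_nat p = (0::'k)"
    and "m \<ge> 1" and "m1 \<ge> 1" and "m2 \<ge> 1"
    and "card (Fsub p (m*m1) :: 'k set) = p ^ (m*m1)"
    and "card (Fsub p (m*m2) :: 'k set) = p ^ (m*m2)"
    and "is_quad_form p m m1 Q"
    and "\<exists>x\<in>Fsub p (m*m1). Q x \<noteq> 0"
    and "N > 0" and "N dvd p - 1" and "coprime N ((p^m - 1) div (p - 1))"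
    and "\<theta> \<in> Fsub p m" and "\<theta> ^ ((p^m - 1) div N) = 1"
    and "\<forall>k. 0 < k \<and> k < (p^m - 1) div N \<longrightarrow> \<theta> ^ k \<noteq> 1"
    and "1 \<le> r" and "r \<le> m * (m2 + 1)"
  shows "let q = real p ^ m; M = m1 + m2; rQ = qf_rank p m m1 Q;
             d = real (ghw (Fsub p 1) (idx p m m1 m2 N) (code_QN p m m1 m2 N Q \<theta>) r);
             A = q ^ M * (q - 1) / (real p ^ r * real N);
             t = 1 / q ^ (rQ div 2)
         in (even rQ \<and> eps_sign p m m1 Q = 1 \<longrightarrow>
               d = (if r \<le> m then A * (real p ^ r - 1) * (1 - t)
                    else A * (real p ^ r - 1 - t * (q - 1)))) \<and>
            (even rQ \<and> eps_sign p m m1 Q = -1 \<longrightarrow>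
               d = (if r \<le> m * m2 then A * (real p ^ r - 1)
                    else A * (real p ^ r - 1 + t * (real p ^ (r - m * m2) - 1)))) \<and>
            (odd rQ \<longrightarrow> d = A * (real p ^ r - 1))"
proof -
  interpret c0: prime_char p "TYPE('k)"
    using assms by unfold_locales
  \<comment> \<open>The size of \<open>Fq\<close> descends from that of an extension.\<close>
  have "card (Fsub p m :: 'k set) = p ^ m"
    by (rule c0.card_Fsub_subfield) (use assms in auto)
  then interpret descended_code p "TYPE('k)" m m1 Q m2 N \<theta>
    using assms by unfold_locales
  let ?r = "qf_rank p m m1 Q" and ?A = "real q ^ (m1 + m2) * (real q - 1) / (real p ^ r * real N)"
  let ?t = "1 / real q ^ (?r div 2)" and ?d = "real (ghw Fp I code r)"
  have even: "?r = 2 * (?r div 2)" if "even ?r" using that by simp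
  have 1: "?d = (if r \<le> m then ?A * (real p ^ r - 1) * (1 - ?t)
      else ?A * (real p ^ r - 1 - ?t * (real q - 1)))" if "even ?r" "eps_sign p m m1 Q = 1"
  proof -
    have b: "bias = ?t" using bias_even_rank[OF even[OF that(1)]] that(2) by simp
    hence "?d = weight r (p ^ min r m)"
      using ghw_bias_nonneg assms by simp
    also have "\<dots> = ?A * (real p ^ r - 1 - (real (p ^ min r m) - 1) * ?t)"
      unfolding weight_def b ..
    finally have "?d = ?A * (real p ^ r - 1 - (real (p ^ min r m) - 1) * ?t)" .
    \<comment> \<open>For r \<le> m both terms share the factor p^r - 1, which gives the product
      form.\<close>
    moreover have "a * (x - 1 - (x - 1) * t) = a * (x - 1) * (1 - t)" for a x t :: real
      by (simp add: algebra_simps)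
    ultimately show ?thesis by (simp only: min_def of_nat_power mult.commute[of ?t] split: if_split) simp
  qed
  have 2: "?d = (if r \<le> m * m2 then ?A * (real p ^ r - 1)
      else ?A * (real p ^ r - 1 + ?t * (real p ^ (r - m * m2) - 1)))"
    if "even ?r" "eps_sign p m m1 Q = - 1"
  proof -
    have b: "bias = - ?t" using bias_even_rank[OF even[OF that(1)]] that(2) by simp
    hence "?d = weight r (p ^ (r - m * m2))"
      using ghw_bias_nonpos assms by simp
    also have "\<dots> = ?A * (real p ^ r - 1 - (real (p ^ (r - m * m2)) - 1) * - ?t)"
      unfolding weight_def b ..
    finally have "?d = ?A * (real p ^ r - 1 - (real (p ^ (r - m * m2)) - 1) * - ?t)" .
    thus ?thesis by (simp add: mult.commute[of ?t])
  qed
  \<comment> \<open>With zero bias \<open>weight\<close> does not depend on its second argument, so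
    all subcodes of dimension r have the same support size.\<close>
  have 3: "?d = ?A * (real p ^ r - 1)" if "odd ?r"
    using ghw_bias_nonneg assms bias_odd_rank[OF that] by (simp add: weight_def)
  show ?thesis
    using 1 2 3 unfolding Let_def Fp_def of_nat_power by blast
qed

end
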